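(* Let $(A_t)_{t\in[0,T]}$ and $(B_t)_{t\in[0,T]}$ be progressively measurable $\mathbb R$-valued processes such that $\mathbb E\int_0^T|B_t|^2dt<\infty$, and let $p\in[1,\infty)$. Then $$\left\|\int_0^T|A_tB_t|dt\right\|_p\le\sqrt{2p}\;\|A\|_{\mathbb H_p(S_2)}\|B\|_{\mathrm{BMO}(S_2)}.$$ If $c_p^{\mathrm{opt}}$ denotes the optimal constant (in place of $\sqrt{2p}$) in this inequality, then $$\inf_{p\in[2,\infty)}\frac{c_p^{\mathrm{opt}}}{\sqrt p}>0,$$ i.e. the order of magnitude $\sqrt p$ of the constant as $p\to\infty$ is optimal.
   Context: Let $T>0$. The stochastic basis is $(\mathcal O,\mathcal A,\mathbb Q,(\mathcal A_t)_{t\in[0,T]})$, where $(\mathcal O,\mathcal A,\mathbb Q)$ is complete, $(\mathcal A_t)$ is right-continuous, $\mathcal A_0$ contains all null-sets, and $\mathcal A=\mathcal A_T$. For progressively measurable real processes, $$\|A\|_{\mathbb H_p(S_2)}:=\left\|\left(\int_0^T|A_s|^2ds\right)^{1/2}\right\|_p,\qquad\|B\|_{\mathrm{BMO}(S_2)}:=\sup_{t\in[0,T]}\left\|\mathbb E\left(\int_t^T|B_s|^2ds\,\Big|\,\mathcal A_t\right)\right\|_\infty^{1/2}.$$ The optimal constant $c_p^{\mathrm{opt}}$ is the smallest constant such that the inequality holds for all stochastic bases of this type and all processes $A,B$ as in the statement. *)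

theory Defs
  imports "HOL-Probability.Probability" "HOL-Library.Infinite_Typeclass"
begin

text \<open>
  All norms take values in \<^typ>\<open>ennreal\<close>, since nothing forces \<^term>\<open>\<integral>\<^sup>+ s\<in>{0..T}. ennreal ((A s \<omega>)\<^sup>2) \<partial>lborel\<close>
  to be finite; products use the convention \<open>0 * \<infinity> = 0\<close>.
\<close>

locale stochastic_basis = prob_space M + complete_measure M
  for M :: "'a measure" +
  fixes F :: "real \<Rightarrow> 'a measure" and T :: real
  assumes T_pos: "0 < T"
    and subalgebra_F: "\<And>t. t \<in> {0..T} \<Longrightarrow> subalgebra M (F t)"
    and sets_F_mono: "\<And>s t. 0 \<le> s \<Longrightarrow> s \<le> t \<Longrightarrow> t \<le> T \<Longrightarrow> sets (F s) \<subseteq> sets (F t)"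
    and right_continuous: "\<And>t. t \<in> {0..<T} \<Longrightarrow> sets (F t) = (\<Inter>s\<in>{t<..T}. sets (F s))"
    and null_sets_F_0: "null_sets M \<subseteq> sets (F 0)"
    and sets_F_T: "sets (F T) = sets M"

definition progressively_measurable ::
    "(real \<Rightarrow> 'a measure) \<Rightarrow> real \<Rightarrow> (real \<Rightarrow> 'a \<Rightarrow> real) \<Rightarrow> bool" where
  "progressively_measurable F T X \<longleftrightarrow>
     (\<forall>t\<in>{0..T}. (\<lambda>(s, \<omega>). X s \<omega>) \<in>
        borel_measurable (restrict_space borel {0..t} \<Otimes>\<^sub>M F t))"

text \<open>Only used with exponent \<open>a > 0\<close>, where \<open>\<infinity>\<close> to the power \<open>a\<close> is \<open>\<infinity>\<close>.\<close>
definition ennpowr :: "ennreal \<Rightarrow> real \<Rightarrow> ennreal" where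
  "ennpowr x a = (if x = \<top> then \<top> else ennreal (enn2real x powr a))"

definition Lp_norm :: "'a measure \<Rightarrow> real \<Rightarrow> ('a \<Rightarrow> ennreal) \<Rightarrow> ennreal" where
  "Lp_norm M p X = ennpowr (\<integral>\<^sup>+ \<omega>. ennpowr (X \<omega>) p \<partial>M) (1 / p)"

definition H_norm ::
    "'a measure \<Rightarrow> real \<Rightarrow> real \<Rightarrow> (real \<Rightarrow> 'a \<Rightarrow> real) \<Rightarrow> ennreal" where
  "H_norm M T p A =
     Lp_norm M p (\<lambda>\<omega>. ennpowr (\<integral>\<^sup>+ s\<in>{0..T}. ennreal (\<bar>A s \<omega>\<bar>\<^sup>2) \<partial>lborel) (1 / 2))"

definition BMO_norm ::
    "'a measure \<Rightarrow> (real \<Rightarrow> 'a measure) \<Rightarrow> real \<Rightarrow> (real \<Rightarrow> 'a \<Rightarrow> real) \<Rightarrow> ennreal" where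
  "BMO_norm M F T B =
     (SUP t\<in>{0..T}. ennpowr
        (esssup M (nn_cond_exp M (F t) (\<lambda>\<omega>. \<integral>\<^sup>+ s\<in>{t..T}. ennreal (\<bar>B s \<omega>\<bar>\<^sup>2) \<partial>lborel)))
        (1 / 2))"

definition admissible ::
    "'a measure \<Rightarrow> (real \<Rightarrow> 'a measure) \<Rightarrow> real \<Rightarrow> (real \<Rightarrow> 'a \<Rightarrow> real) \<Rightarrow> (real \<Rightarrow> 'a \<Rightarrow> real) \<Rightarrow> bool" where
  "admissible M F T A B \<longleftrightarrow>
     stochastic_basis M F T \<and>
     progressively_measurable F T A \<and> progressively_measurable F T B \<and>
     (\<integral>\<^sup>+ \<omega>. (\<integral>\<^sup>+ s\<in>{0..T}. ennreal (\<bar>B s \<omega>\<bar>\<^sup>2) \<partial>lborel) \<partial>M) < \<infinity>"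

definition product_bound ::
    "'a measure \<Rightarrow> (real \<Rightarrow> 'a measure) \<Rightarrow> real \<Rightarrow> real \<Rightarrow> ennreal \<Rightarrow>
      (real \<Rightarrow> 'a \<Rightarrow> real) \<Rightarrow> (real \<Rightarrow> 'a \<Rightarrow> real) \<Rightarrow> bool" where
  "product_bound M F T p c A B \<longleftrightarrow>
     Lp_norm M p (\<lambda>\<omega>. \<integral>\<^sup>+ s\<in>{0..T}. ennreal \<bar>A s \<omega> * B s \<omega>\<bar> \<partial>lborel)
       \<le> c * H_norm M T p A * BMO_norm M F T B"

text \<open>
  The optimal constant for the time horizon \<open>T\<close> and the exponent \<open>p\<close>. As HOL has no quantification
  over types, the sample spaces range over all subsets of a type \<open>'a\<close>, which is a parameter.
  Requiring the inequality for more stochastic bases can only increase the constant, so a lower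
  bound for any one choice of \<open>'a\<close> is also one for the constant over all stochastic bases.
\<close>
definition c_opt :: "'a itself \<Rightarrow> real \<Rightarrow> real \<Rightarrow> ennreal" where
  "c_opt _ T p =
     Inf {c. \<forall>(M :: 'a measure) F A B. admissible M F T A B \<longrightarrow> product_bound M F T p c A B}"

end

theory Submission
  imports Defs
begin

text \<open>
  Upper bound: put \<open>\<alpha> t = \<integral> A\<^sup>2\<close> over \<open>[0, t]\<close>, \<open>\<phi> = sqrt \<alpha>\<close> and \<open>Z t = \<integral> \<phi> B\<^sup>2\<close> over \<open>[0, t]\<close>. Since
  \<open>A\<^sup>2 dt = d\<alpha>\<close>, the Cauchy--Schwarz inequality gives \<open>(\<integral> \<bar>A B\<bar>)\<^sup>2 \<le> (\<integral> d\<alpha> / \<phi>) Z T = 2 \<phi> T * Z T\<close>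
  pathwise. If \<open>K\<close> is the squared BMO norm, then \<open>E \<integral> \<psi> B\<^sup>2 \<le> K E (\<psi> T)\<close> for increasing adapted
  \<open>\<psi>\<close>. Applied to \<open>\<psi> = p Z ^ (p - 1) \<phi>\<close> this bounds \<open>E (Z T ^ p)\<close> by
  \<open>p K E (Z T ^ (p - 1) * \<phi> T)\<close>, so Young's inequality shows that the \<open>p\<close>-norm of \<open>Z T\<close> is at most \<open>p K\<close>
  times that of \<open>\<phi> T\<close>.

  Lower bound: let \<open>A = B\<close> be the indicator of \<open>{s. s < \<tau>}\<close> for a geometric time \<open>\<tau>\<close> on the grid of
  mesh \<open>\<delta> = T / (n + 1)\<close>, truncated at \<open>T\<close>, with \<open>n = \<lfloor>p\<rfloor>\<close>, in the filtration that reveals \<open>\<tau>\<close>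
  when it occurs. By lack of memory the BMO norm is at most \<open>sqrt (2 \<delta>)\<close>, whereas the \<open>p\<close>-norm of
  \<open>\<tau>\<close> is at least \<open>T / 2\<close>, since \<open>\<tau> = T\<close> with probability \<open>2 ^ -n\<close>.
\<close>

section \<open>Change of variables along a cumulative integral\<close>

text \<open>Probability integral transform for a finite measure. It suffices to compare half-lines.
  Without atoms the cdf is continuous, so for \<open>x\<close> between 0 and the total mass the set
  where the cdf exceeds \<open>x\<close> is a half-line \<open>{s<..}\<close> with
  \<open>cdf M s = x\<close>, and this has the total mass minus \<open>x\<close>.\<close>

lemma (in finite_borel_measure) distr_cdf_eq_uniform:
  assumes atomless: "\<And>x. measure M {x} = 0"
  shows "distr M borel (cdf M) = density lborel (indicator {0..measure M UNIV})"
proof (rule measure_eqI_lessThan)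
  have cont: "continuous_on UNIV (cdf M)"
    using atomless isCont_cdf by (simp add: continuous_on_eq_continuous_at)
  have [measurable]: "cdf M \<in> M \<rightarrow>\<^sub>M borel"
    using borel_measurable_continuous_onI[OF cont] M_is_borel by (simp cong: measurable_cong_sets)
  let ?m = "measure M UNIV"
  have le_m: "cdf M s \<le> ?m" for s using cdf_bounded borel_UNIV by simp
  fix x :: real
  have L: "emeasure (distr M borel (cdf M)) {x<..} = emeasure M {s. x < cdf M s}"
    by (subst emeasure_distr) (auto simp: borel_UNIV vimage_def)
  have R: "emeasure (density lborel (indicator {0..?m})) {x<..} = ennreal (?m - max 0 x)"
  proof -
    have "emeasure (density lborel (indicator {0..?m})) {x<..} = emeasure lborel ({0..?m} \<inter> {x<..})"
      by (simp add: emeasure_restricted)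
    also have "{0..?m} \<inter> {x<..} = (if x < 0 then {0..?m} else {x<..?m})" by auto
    also have "emeasure lborel \<dots> = ennreal (?m - max 0 x)"
      by (cases "x \<le> ?m") (auto simp: max_def ennreal_neg)
    finally show ?thesis .
  qed
  have "measure M {s. x < cdf M s} = max 0 (?m - max 0 x)"
  proof -
    consider "x < 0" | "?m \<le> x" | "0 \<le> x" "x < ?m" by linarith
    then show ?thesis
    proof cases
      case 1
      then have "{s. x < cdf M s} = UNIV"
        using cdf_nonneg by (auto intro: less_le_trans)
      then show ?thesis using 1 by (simp add: measure_nonneg)
    next
      case 2
      then have "{s. x < cdf M s} = {}"
        using le_m by (auto simp: not_less intro: order_trans)
      moreover have "0 \<le> ?m" by simp
      ultimately show ?thesis using 2 by auto
    next
      case 3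
      let ?S = "{s. cdf M s \<le> x}"
      show ?thesis
      proof (cases "?S = {}")
        case True
        then have eq: "{s. x < cdf M s} = UNIV" by (simp add: not_le set_eq_iff)
        \<comment> \<open>A cdf above \<open>x\<close> everywhere has limit 0 at minus infinity,
          which forces \<open>x = 0\<close>; both sides are then the full mass.\<close>
        have "x \<le> 0"
          using cdf_lim_at_bot True
          by (intro tendsto_lowerbound[OF cdf_lim_at_bot]) (auto intro!: always_eventually less_imp_le simp: not_le)
        with eq 3 show ?thesis by simp
      next
        case False
        have "eventually (\<lambda>s. x < cdf M s) at_top"
          using order_tendstoD(1)[OF cdf_lim_at_top] 3 by (simp add: borel_UNIV)
        then obtain u where u: "\<And>s. u \<le> s \<Longrightarrow> x < cdf M s"
          by (auto simp: eventually_at_top_linorder)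
        have bdd: "bdd_above ?S"
          using u by (intro bdd_aboveI[of _ u]) (meson linorder_le_cases mem_Collect_eq not_le)
        have "closed ?S" using cont by (intro closed_Collect_le) auto
        define s where "s = Sup ?S"
        have s: "cdf M s \<le> x"
          using closed_contains_Sup[OF False bdd \<open>closed ?S\<close>] by (simp add: s_def)
        have s': "x < cdf M r" if "s < r" for r
          using that cSup_upper[OF _ bdd, of r] by (force simp: s_def)
        have eq: "{r. x < cdf M r} = {s<..}"
        proof safe
          fix r assume "x < cdf M r"
          with s cdf_nondecreasing[of r s] show "s < r" by linarith
        qed (use s' in auto)
        \<comment> \<open>Values just to the right of \<open>s\<close> exceed \<open>x\<close>, and
          right-continuity carries the bound over to \<open>s\<close>.\<close>
        have "x \<le> cdf M s"
        proof (rule tendsto_lowerbound)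
          show "(cdf M \<longlongrightarrow> cdf M s) (at_right s)"
            using cdf_is_right_cont[of s] by (simp add: continuous_within)
          show "eventually (\<lambda>r. x \<le> cdf M r) (at_right s)"
            using s' by (auto simp: eventually_at_right_less eventually_at_filter intro!: always_eventually less_imp_le)
        qed simp
        with s have "cdf M s = x" by simp
        moreover have "measure M {s<..} = ?m - cdf M s"
        proof -
          have "measure M (space M - {..s}) = measure M (space M) - measure M {..s}"
            by (rule finite_measure_compl) auto
          moreover have "space M - {..s} = {s<..}" by (auto simp: borel_UNIV)
          ultimately show ?thesis by (simp add: cdf_def borel_UNIV)
        qed
        ultimately show ?thesis using eq 3 by simp
      qed
    qed
  qed
  then have "emeasure M {s. x < cdf M s} = ennreal (?m - max 0 x)"
    by (simp add: emeasure_eq_measure max_def ennreal_neg)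
  then show "emeasure (distr M borel (cdf M)) {x<..} = emeasure (density lborel (indicator {0..?m})) {x<..}"
    unfolding L R .
  show "emeasure (distr M borel (cdf M)) {x<..} < \<infinity>"
    unfolding L by (simp add: emeasure_eq_measure)
qed simp_all

text \<open>The substitution \<open>x = C s\<close>, \<open>dx = g s ds\<close>, without any
  differentiation: \<open>C\<close> is the cdf of the measure with density \<open>g\<close> on
  \<open>{0..T}\<close>, which has no atoms because points are Lebesgue null, so its image under
  \<open>C\<close> is uniform. Being a cdf, \<open>C\<close> is defined, continuous and hence Borel
  on the whole line.\<close>

lemma cumulative_integral_change_of_variables:
  fixes g :: "real \<Rightarrow> ennreal" and T :: real
  assumes [measurable]: "g \<in> borel_measurable borel" and T: "0 \<le> T"
    and fin: "(\<integral>\<^sup>+ s\<in>{0..T}. g s \<partial>lborel) < \<infinity>"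
  obtains C :: "real \<Rightarrow> real" where
    "continuous_on UNIV C" "mono C" "\<And>s. 0 \<le> C s"
    "\<And>s. s \<in> {0..T} \<Longrightarrow> (\<integral>\<^sup>+ u\<in>{0..s}. g u \<partial>lborel) = ennreal (C s)"
    "\<And>h. h \<in> borel_measurable borel \<Longrightarrow>
      (\<integral>\<^sup>+ s\<in>{0..T}. h (C s) * g s \<partial>lborel) = (\<integral>\<^sup>+ x\<in>{0..C T}. h x \<partial>lborel)"
proof -
  define N where "N = density lborel (\<lambda>s. g s * indicator {0..T} s)"
  have emN: "emeasure N X = (\<integral>\<^sup>+ s\<in>X. g s * indicator {0..T} s \<partial>lborel)" if "X \<in> sets borel" for X
    unfolding N_def using that by (subst emeasure_density) auto
  have nnN: "(\<integral>\<^sup>+ s. f s \<partial>N) = (\<integral>\<^sup>+ s. g s * indicator {0..T} s * f s \<partial>lborel)"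
    if "f \<in> borel_measurable borel" for f
    unfolding N_def using that by (subst nn_integral_density) auto
  have sets_N[measurable_cong]: "sets N = sets borel" by (simp add: N_def)
  have UN: "emeasure N UNIV = (\<integral>\<^sup>+ s\<in>{0..T}. g s \<partial>lborel)"
    by (simp add: emN)
  interpret N: finite_borel_measure N
    using UN fin by (intro finite_borel_measure.intro finite_measureI finite_borel_measure_axioms.intro)
      (simp_all add: N_def)
  have atom: "measure N {x} = 0" for x
  proof -
    have "AE s in lborel. g s * indicator {0..T} s * indicator {x} s = 0"
      using AE_lborel_singleton[of x] by eventually_elim (auto simp: indicator_def)
    then have "(\<integral>\<^sup>+ s. g s * indicator {0..T} s * indicator {x} s \<partial>lborel) = 0"
      by (subst nn_integral_0_iff_AE) auto
    then show ?thesis using emN[of "{x}"] by (simp add: measure_def)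
  qed
  have cont: "continuous_on UNIV (cdf N)"
    using atom N.isCont_cdf by (simp add: continuous_on_eq_continuous_at)
  then have [measurable]: "cdf N \<in> borel_measurable borel"
    by (rule borel_measurable_continuous_onI)
  have val: "(\<integral>\<^sup>+ u\<in>{0..s}. g u \<partial>lborel) = ennreal (cdf N s)" if "s \<in> {0..T}" for s
  proof -
    have "(\<integral>\<^sup>+ u\<in>{0..s}. g u \<partial>lborel) = (\<integral>\<^sup>+ u. g u * indicator {0..T} u * indicator {..s} u \<partial>lborel)"
      using that by (intro nn_integral_cong) (auto simp: indicator_def)
    also have "\<dots> = emeasure N {..s}" by (simp add: emN)
    finally show ?thesis by (simp add: cdf_def N.emeasure_eq_measure)
  qed
  have CT: "cdf N T = measure N UNIV"
    using val[of T] T UN by (simp add: N.emeasure_eq_measure cdf_def)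
  show ?thesis
  proof (rule that[of "cdf N"])
    show "mono (cdf N)" by (simp add: mono_def N.cdf_nondecreasing)
    fix h :: "real \<Rightarrow> ennreal" assume [measurable]: "h \<in> borel_measurable borel"
    have "(\<integral>\<^sup>+ s\<in>{0..T}. h (cdf N s) * g s \<partial>lborel)
        = (\<integral>\<^sup>+ s. g s * indicator {0..T} s * h (cdf N s) \<partial>lborel)"
      by (simp add: ac_simps)
    also have "\<dots> = (\<integral>\<^sup>+ s. h (cdf N s) \<partial>N)"
      by (rule nnN[symmetric]) measurable
    also have "\<dots> = (\<integral>\<^sup>+ x. h x \<partial>distr N borel (cdf N))"
      by (subst nn_integral_distr) auto
    also have "\<dots> = (\<integral>\<^sup>+ x\<in>{0..cdf N T}. h x \<partial>lborel)"
      unfolding N.distr_cdf_eq_uniform[OF atom] CT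
      by (subst nn_integral_density) (auto intro!: nn_integral_cong simp: ac_simps)
    finally show "(\<integral>\<^sup>+ s\<in>{0..T}. h (cdf N s) * g s \<partial>lborel) = (\<integral>\<^sup>+ x\<in>{0..cdf N T}. h x \<partial>lborel)" .
  qed (use cont val N.cdf_nonneg in auto)
qed

lemma nn_integral_powr_from_0:
  assumes "-1 < a" "0 \<le> c"
  shows "(\<integral>\<^sup>+ x\<in>{0..c}. ennreal (x powr a) \<partial>lborel) = ennreal (c powr (a + 1) / (a + 1))"
  using has_integral_powr_from_0[OF assms] by (intro nn_integral_has_integral_lebesgue') auto

section \<open>Progressive processes and increasing integrands\<close>

text \<open>Extending by 0 beyond \<open>t\<close> on the full product with \<open>lborel\<close>,
  with the time as second coordinate, lets Tonelli's theorem be applied directly to integrals over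
  time.\<close>

definition progressive_nn ::
    "(real \<Rightarrow> 'a measure) \<Rightarrow> real \<Rightarrow> (real \<Rightarrow> 'a \<Rightarrow> ennreal) \<Rightarrow> bool" where
  "progressive_nn F T X \<longleftrightarrow>
     (\<forall>t\<in>{0..T}. (\<lambda>(\<omega>, s). X s \<omega> * indicator {0..t} s) \<in> borel_measurable (F t \<Otimes>\<^sub>M lborel))"

text \<open>Bridge from the notion in the theorem to the encoding above: swap the coordinates, then
  extend by 0 from \<open>{0..t}\<close> to the whole line.\<close>

lemma progressive_nn_compose_real:
  fixes f :: "real \<Rightarrow> ennreal"
  assumes X: "progressively_measurable F T X" and [measurable]: "f \<in> borel_measurable borel"
  shows "progressive_nn F T (\<lambda>s \<omega>. f (X s \<omega>))"
  unfolding progressive_nn_def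
proof
  fix t assume "t \<in> {0..T}"
  then have X_t [measurable]:
    "(\<lambda>(s, \<omega>). X s \<omega>) \<in> borel_measurable (restrict_space borel {0..t} \<Otimes>\<^sub>M F t)"
    using X by (auto simp: progressively_measurable_def)
  let ?D = "space (F t) \<times> {0..t}"
  have D: "?D \<inter> space (F t \<Otimes>\<^sub>M lborel) \<in> sets (F t \<Otimes>\<^sub>M lborel)"
    by (simp add: space_pair_measure Times_Int_Times)
  have swap: "(\<lambda>(\<omega>, s). (s, \<omega>)) \<in>
      restrict_space (F t \<Otimes>\<^sub>M lborel) ?D \<rightarrow>\<^sub>M restrict_space borel {0..t} \<Otimes>\<^sub>M F t"
    unfolding split_beta'
    by (intro measurable_Pair measurable_restrict_space2 measurable_restrict_space1)
      (auto simp: space_restrict_space)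
  have "(\<lambda>x. f ((\<lambda>(s, \<omega>). X s \<omega>) ((\<lambda>(\<omega>, s). (s, \<omega>)) x))) \<in>
      borel_measurable (restrict_space (F t \<Otimes>\<^sub>M lborel) ?D)"
    by (intro measurable_compose[OF measurable_compose[OF swap X_t]]) simp
  then have "(\<lambda>x. (case x of (\<omega>, s) \<Rightarrow> f (X s \<omega>)) * indicator ?D x) \<in> borel_measurable (F t \<Otimes>\<^sub>M lborel)"
    by (subst borel_measurable_restrict_space_iff_ennreal[symmetric, OF D]) (simp add: split_beta')
  then show "(\<lambda>(\<omega>, s). f (X s \<omega>) * indicator {0..t} s) \<in> borel_measurable (F t \<Otimes>\<^sub>M lborel)"
    by (rule measurable_cong[THEN iffD1, rotated]) (auto simp: space_pair_measure indicator_def)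
qed

lemma progressive_nn_compose:
  fixes f :: "ennreal \<Rightarrow> ennreal"
  assumes X: "progressive_nn F T X" and [measurable]: "f \<in> borel_measurable borel"
  shows "progressive_nn F T (\<lambda>s \<omega>. f (X s \<omega>))"
  unfolding progressive_nn_def
proof
  fix t assume "t \<in> {0..T}"
  then have [measurable]: "(\<lambda>(\<omega>, s). X s \<omega> * indicator {0..t} s) \<in> borel_measurable (F t \<Otimes>\<^sub>M lborel)"
    using X by (auto simp: progressive_nn_def)
  \<comment> \<open>\<open>f\<close> may be nonzero at 0, so the indicator is applied once more
    outside \<open>f\<close>.\<close>
  have "(\<lambda>x. f ((\<lambda>(\<omega>, s). X s \<omega> * indicator {0..t} s) x) * indicator {0..t} (snd x))
      \<in> borel_measurable (F t \<Otimes>\<^sub>M lborel)"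
    by measurable
  then show "(\<lambda>(\<omega>, s). f (X s \<omega>) * indicator {0..t} s) \<in> borel_measurable (F t \<Otimes>\<^sub>M lborel)"
    by (rule measurable_cong[THEN iffD1, rotated]) (auto simp: indicator_def)
qed

lemma progressive_nn_mult:
  assumes X: "progressive_nn F T X" and Y: "progressive_nn F T Y"
  shows "progressive_nn F T (\<lambda>s \<omega>. X s \<omega> * Y s \<omega>)"
  unfolding progressive_nn_def
proof
  fix t assume "t \<in> {0..T}"
  then have [measurable]: "(\<lambda>(\<omega>, s). X s \<omega> * indicator {0..t} s) \<in> borel_measurable (F t \<Otimes>\<^sub>M lborel)"
      "(\<lambda>(\<omega>, s). Y s \<omega> * indicator {0..t} s) \<in> borel_measurable (F t \<Otimes>\<^sub>M lborel)"
    using X Y by (auto simp: progressive_nn_def)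
  have "(\<lambda>x. (\<lambda>(\<omega>, s). X s \<omega> * indicator {0..t} s) x * (\<lambda>(\<omega>, s). Y s \<omega> * indicator {0..t} s) x)
      \<in> borel_measurable (F t \<Otimes>\<^sub>M lborel)"
    by measurable
  then show "(\<lambda>(\<omega>, s). X s \<omega> * Y s \<omega> * indicator {0..t} s) \<in> borel_measurable (F t \<Otimes>\<^sub>M lborel)"
    by (rule measurable_cong[THEN iffD1, rotated]) (auto simp: indicator_def)
qed

text \<open>For \<open>s\<close> in \<open>{0..t}\<close> the integral over \<open>{0..s}\<close>
  sees only values of \<open>X\<close> up to time \<open>t\<close>. Its integrand is jointly
  measurable in the sample point, the end point \<open>s\<close> and the variable \<open>u\<close>,
  and Tonelli's theorem integrates out \<open>u\<close>.\<close>

lemma progressive_nn_integral: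
  assumes X: "progressive_nn F T X"
  shows "progressive_nn F T (\<lambda>s \<omega>. \<integral>\<^sup>+ u\<in>{0..s}. X u \<omega> \<partial>lborel)"
  unfolding progressive_nn_def
proof
  fix t assume "t \<in> {0..T}"
  then have X_t: "(\<lambda>(\<omega>, s). X s \<omega> * indicator {0..t} s) \<in> borel_measurable (F t \<Otimes>\<^sub>M lborel)"
    using X by (auto simp: progressive_nn_def)
  have X': "(\<lambda>x. X (snd x) (fst (fst x)) * indicator {0..t} (snd x)) \<in>
      borel_measurable ((F t \<Otimes>\<^sub>M lborel) \<Otimes>\<^sub>M lborel)"
    using measurable_compose[OF _ X_t, of "\<lambda>x. (fst (fst x), snd x)" "(F t \<Otimes>\<^sub>M lborel) \<Otimes>\<^sub>M lborel"]
    by (simp add: split_beta')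
  have "(\<lambda>x. if snd x \<le> snd (fst x) then 1 else 0 :: ennreal) \<in>
      borel_measurable ((F t \<Otimes>\<^sub>M (lborel :: real measure)) \<Otimes>\<^sub>M lborel)"
    by measurable
  from borel_measurable_times_ennreal[OF X' this]
  have "(\<lambda>(x, u). (X u (fst x) * indicator {0..t} u) * indicator {..snd x} u) \<in>
      borel_measurable ((F t \<Otimes>\<^sub>M lborel) \<Otimes>\<^sub>M lborel)"
    by (simp add: split_beta' indicator_def of_bool_def)
  then have [measurable]: "(\<lambda>x. \<integral>\<^sup>+ u. (X u (fst x) * indicator {0..t} u) * indicator {..snd x} u \<partial>lborel) \<in>
      borel_measurable (F t \<Otimes>\<^sub>M lborel)"
    by (rule lborel.borel_measurable_nn_integral)
  have "(\<lambda>x. (\<integral>\<^sup>+ u. (X u (fst x) * indicator {0..t} u) * indicator {..snd x} u \<partial>lborel)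
      * indicator {0..t} (snd x)) \<in> borel_measurable (F t \<Otimes>\<^sub>M lborel)"
    by measurable
  then show "(\<lambda>(\<omega>, s). (\<integral>\<^sup>+ u\<in>{0..s}. X u \<omega> \<partial>lborel) * indicator {0..t} s)
      \<in> borel_measurable (F t \<Otimes>\<^sub>M lborel)"
    by (rule measurable_cong[THEN iffD1, rotated])
      (auto simp: indicator_def split_beta' intro!: nn_integral_cong)
qed

lemma progressive_nn_joint:
  assumes "progressive_nn F T X" "t \<in> {0..T}"
  shows "(\<lambda>(\<omega>, s). X s \<omega> * indicator {0..t} s) \<in> borel_measurable (F t \<Otimes>\<^sub>M lborel)"
  using assms by (auto simp: progressive_nn_def)

lemma progressive_nn_section:
  assumes "progressive_nn F T X" "t \<in> {0..T}"
  shows "X t \<in> borel_measurable (F t)"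
  using measurable_compose[OF _ progressive_nn_joint[OF assms], of "\<lambda>\<omega>. (\<omega>, t)" "F t"] assms by simp

text \<open>Abel summation: with tails \<open>R\<close> and pieces \<open>\<beta>\<close>, the
  integrand equals \<open>\<psi> 0 * R 0\<close> plus the sum of
  \<open>(\<psi> (Suc i) - \<psi> i) * R (Suc i)\<close>. Each of these terms costs at most
  \<open>K\<close> times the expectation of its weight, and the weights telescope to
  \<open>\<psi> m\<close>. The last term \<open>\<psi> m * R m\<close> is kept to make the induction
  close.\<close>

lemma nn_integral_discrete_parts_le:
  fixes \<psi> \<beta> R :: "nat \<Rightarrow> 'a \<Rightarrow> ennreal"
  assumes [measurable]: "\<And>i. \<psi> i \<in> borel_measurable M" "\<And>i. \<beta> i \<in> borel_measurable M"
      "\<And>i. R i \<in> borel_measurable M"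
    and R: "\<And>i \<omega>. i < n \<Longrightarrow> \<omega> \<in> space M \<Longrightarrow> R i \<omega> = \<beta> i \<omega> + R (Suc i) \<omega>"
    and \<psi>: "\<And>i \<omega>. i < n \<Longrightarrow> \<omega> \<in> space M \<Longrightarrow> \<psi> i \<omega> \<le> \<psi> (Suc i) \<omega>"
    and init: "(\<integral>\<^sup>+ \<omega>. \<psi> 0 \<omega> * R 0 \<omega> \<partial>M) \<le> K * (\<integral>\<^sup>+ \<omega>. \<psi> 0 \<omega> \<partial>M)"
    and incr: "\<And>i. i < n \<Longrightarrow> (\<integral>\<^sup>+ \<omega>. (\<psi> (Suc i) \<omega> - \<psi> i \<omega>) * R (Suc i) \<omega> \<partial>M)
      \<le> K * (\<integral>\<^sup>+ \<omega>. \<psi> (Suc i) \<omega> - \<psi> i \<omega> \<partial>M)"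
    and "m \<le> n"
  shows "(\<integral>\<^sup>+ \<omega>. (\<Sum>i<m. \<psi> i \<omega> * \<beta> i \<omega>) + \<psi> m \<omega> * R m \<omega> \<partial>M) \<le> K * (\<integral>\<^sup>+ \<omega>. \<psi> m \<omega> \<partial>M)"
  using \<open>m \<le> n\<close>
proof (induction m)
  case 0
  then show ?case using init by simp
next
  case (Suc m)
  let ?\<delta> = "\<lambda>\<omega>. \<psi> (Suc m) \<omega> - \<psi> m \<omega>"
  have \<delta>: "\<psi> (Suc m) \<omega> = \<psi> m \<omega> + ?\<delta> \<omega>" if "\<omega> \<in> space M" for \<omega>
    using \<psi> that Suc.prems by (intro ennreal_ineq_diff_add) auto
  have "(\<integral>\<^sup>+ \<omega>. (\<Sum>i<Suc m. \<psi> i \<omega> * \<beta> i \<omega>) + \<psi> (Suc m) \<omega> * R (Suc m) \<omega> \<partial>M)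
      = (\<integral>\<^sup>+ \<omega>. ((\<Sum>i<m. \<psi> i \<omega> * \<beta> i \<omega>) + \<psi> m \<omega> * R m \<omega>) + ?\<delta> \<omega> * R (Suc m) \<omega> \<partial>M)"
  proof (intro nn_integral_cong)
    fix \<omega> assume \<omega>: "\<omega> \<in> space M"
    show "(\<Sum>i<Suc m. \<psi> i \<omega> * \<beta> i \<omega>) + \<psi> (Suc m) \<omega> * R (Suc m) \<omega>
        = ((\<Sum>i<m. \<psi> i \<omega> * \<beta> i \<omega>) + \<psi> m \<omega> * R m \<omega>) + ?\<delta> \<omega> * R (Suc m) \<omega>"
    proof -
      have "\<psi> (Suc m) \<omega> * R (Suc m) \<omega> = \<psi> m \<omega> * R (Suc m) \<omega> + ?\<delta> \<omega> * R (Suc m) \<omega>"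
        using \<delta>[OF \<omega>] by (metis distrib_right)
      then show ?thesis
        using R[of m \<omega>] Suc.prems \<omega> by (simp add: distrib_left add.assoc)
    qed
  qed
  also have "\<dots> = (\<integral>\<^sup>+ \<omega>. (\<Sum>i<m. \<psi> i \<omega> * \<beta> i \<omega>) + \<psi> m \<omega> * R m \<omega> \<partial>M)
      + (\<integral>\<^sup>+ \<omega>. ?\<delta> \<omega> * R (Suc m) \<omega> \<partial>M)"
    by (intro nn_integral_add) measurable
  also have "\<dots> \<le> K * (\<integral>\<^sup>+ \<omega>. \<psi> m \<omega> \<partial>M) + K * (\<integral>\<^sup>+ \<omega>. ?\<delta> \<omega> \<partial>M)"
    using Suc incr[of m] by (intro add_mono) auto
  also have "\<dots> = K * (\<integral>\<^sup>+ \<omega>. \<psi> m \<omega> + ?\<delta> \<omega> \<partial>M)"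
    by (subst nn_integral_add) (auto simp: distrib_left)
  also have "\<dots> = K * (\<integral>\<^sup>+ \<omega>. \<psi> (Suc m) \<omega> \<partial>M)"
    using \<delta> by (intro arg_cong[where f="(*) K"] nn_integral_cong) simp
  finally show ?case .
qed

text \<open>The sum selects the value of \<open>\<psi>\<close> at the left end of the grid cell
  containing \<open>s\<close>. The cells are open on the left, so this end lies strictly below
  \<open>s\<close> and a left limit of \<open>\<psi>\<close> is enough. Left ends are used because
  they keep a discretised integrand adapted.\<close>

lemma step_function_tendsto_at_left:
  fixes \<psi> :: "real \<Rightarrow> ennreal" and T s :: real
  assumes T: "0 < T" and s: "0 < s" "s \<le> T" and lim: "(\<psi> \<longlongrightarrow> \<psi> s) (at_left s)"
  shows "(\<lambda>n. \<Sum>i<Suc n. \<psi> (T * i / Suc n) * indicator {T * i / Suc n<..T * Suc i / Suc n} s) \<longlonglongrightarrow> \<psi> s"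
proof -
  \<comment> \<open>The largest grid point strictly below \<open>s\<close>.\<close>
  define l where "l n = T * real_of_int (\<lceil>s * Suc n / T\<rceil> - 1) / Suc n" for n
  have step: "(\<Sum>i<Suc n. \<psi> (T * i / Suc n) * indicator {T * i / Suc n<..T * Suc i / Suc n} s) = \<psi> (l n)" for n
  proof -
    define k where "k = \<lceil>s * Suc n / T\<rceil>"
    have k: "1 \<le> k" "k \<le> int (Suc n)"
    proof -
      have "0 < s * Suc n / T" using T s by simp
      moreover have "s * Suc n / T \<le> Suc n"
        using T s by (simp add: pos_divide_le_eq mult.commute[of s] mult_left_mono del: of_nat_Suc)
      ultimately show "1 \<le> k" "k \<le> int (Suc n)"
        unfolding k_def by (simp_all add: ceiling_le_iff del: of_nat_Suc)
    qed
    have *: "(indicator {T * i / Suc n<..T * Suc i / Suc n} s :: ennreal) = (if i = nat (k - 1) then 1 else 0)" for i :: nat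
    proof -
      have "s \<in> {T * i / Suc n<..T * Suc i / Suc n} \<longleftrightarrow> real i < s * Suc n / T \<and> s * Suc n / T \<le> real i + 1"
        using T by (simp add: field_simps del: of_nat_Suc) (simp add: field_simps)
      also have "\<dots> \<longleftrightarrow> k = int i + 1"
        unfolding k_def by (subst ceiling_eq_iff) auto
      also have "\<dots> \<longleftrightarrow> i = nat (k - 1)" using k by auto
      finally show ?thesis by (simp add: indicator_def)
    qed
    show ?thesis
    proof -
      have "(\<Sum>i<Suc n. \<psi> (T * i / Suc n) * indicator {T * i / Suc n<..T * Suc i / Suc n} s)
          = (\<Sum>i<Suc n. if i = nat (k - 1) then \<psi> (T * i / Suc n) else 0)"
        unfolding * by (intro sum.cong) auto
      also have "\<dots> = \<psi> (T * real (nat (k - 1)) / Suc n)"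
        using k by (subst sum.delta) auto
      also have "real (nat (k - 1)) = real_of_int (k - 1)" using k by simp
      finally show ?thesis by (simp add: l_def k_def)
    qed
  qed
  have l_less: "l n < s" for n
  proof -
    have "real_of_int (\<lceil>s * Suc n / T\<rceil> - 1) < s * Suc n / T" by linarith
    then show ?thesis using T by (simp add: l_def field_simps del: of_nat_Suc)
  qed
  have l_ge: "s - T / Suc n \<le> l n" for n
  proof -
    have "s * Suc n / T - 1 \<le> real_of_int (\<lceil>s * Suc n / T\<rceil> - 1)" by linarith
    then have "(s * Suc n / T - 1) * (T / Suc n) \<le> real_of_int (\<lceil>s * Suc n / T\<rceil> - 1) * (T / Suc n)"
      using T by (intro mult_right_mono) auto
    also have "(s * Suc n / T - 1) * (T / Suc n) = s - T / Suc n"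
      using T by (simp add: field_simps del: of_nat_Suc)
    finally show ?thesis by (simp add: l_def mult.commute)
  qed
  have "(\<lambda>n. s - T / Suc n) \<longlonglongrightarrow> s - 0"
    by (intro tendsto_intros LIMSEQ_Suc[OF lim_const_over_n])
  then have "l \<longlonglongrightarrow> s"
    using l_less l_ge by (intro tendsto_sandwich[of "\<lambda>n. s - T / Suc n" l sequentially "\<lambda>_. s"])
      (auto intro!: always_eventually less_imp_le)
  then have "filterlim l (at_left s) sequentially"
    using l_less by (auto simp: filterlim_at intro!: always_eventually)
  from filterlim_compose[OF lim this] show ?thesis unfolding step .
qed


text \<open>Replace \<open>\<psi>\<close> by its values at left grid points and sum by parts: the
  increment of \<open>\<psi>\<close> over a cell is measurable at the right end of the cell, where
  \<open>bound\<close> controls the remaining tail of \<open>b\<close>. Left-continuity of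
  \<open>\<psi>\<close> and Fatou's lemma, once in time and once over the sample space, remove the
  grid.\<close>

lemma nn_integral_increasing_adapted_le:
  fixes \<psi> b :: "real \<Rightarrow> 'a \<Rightarrow> ennreal" and T :: real
  assumes T: "0 < T"
    and sub: "\<And>t. t \<in> {0..T} \<Longrightarrow> subalgebra M (F t)"
    and mono: "\<And>s t. 0 \<le> s \<Longrightarrow> s \<le> t \<Longrightarrow> t \<le> T \<Longrightarrow> sets (F s) \<subseteq> sets (F t)"
    and b: "(\<lambda>(\<omega>, s). b s \<omega> * indicator {0..T} s) \<in> borel_measurable (M \<Otimes>\<^sub>M lborel)"
    and b_fin: "\<And>s \<omega>. b s \<omega> < \<infinity>"
    and bound: "\<And>t f. t \<in> {0..T} \<Longrightarrow> f \<in> borel_measurable (F t) \<Longrightarrow>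
      (\<integral>\<^sup>+ \<omega>. f \<omega> * (\<integral>\<^sup>+ s\<in>{t..T}. b s \<omega> \<partial>lborel) \<partial>M) \<le> K * (\<integral>\<^sup>+ \<omega>. f \<omega> \<partial>M)"
    and \<psi>_adapted: "\<And>t. t \<in> {0..T} \<Longrightarrow> \<psi> t \<in> borel_measurable (F t)"
    and \<psi>_mono: "\<And>s t \<omega>. 0 \<le> s \<Longrightarrow> s \<le> t \<Longrightarrow> t \<le> T \<Longrightarrow> \<omega> \<in> space M \<Longrightarrow> \<psi> s \<omega> \<le> \<psi> t \<omega>"
    and \<psi>_left: "AE \<omega> in M. \<forall>t\<in>{0<..T}. ((\<lambda>s. \<psi> s \<omega>) \<longlongrightarrow> \<psi> t \<omega>) (at_left t)"
  shows "(\<integral>\<^sup>+ \<omega>. (\<integral>\<^sup>+ s\<in>{0..T}. \<psi> s \<omega> * b s \<omega> \<partial>lborel) \<partial>M) \<le> K * (\<integral>\<^sup>+ \<omega>. \<psi> T \<omega> \<partial>M)"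
proof -
  define t where "t n i = T * real i / real (Suc n)" for n i :: nat
  have t_mono: "t n i \<le> t n j" if "i \<le> j" for n i j
    using T that unfolding t_def by (intro divide_right_mono mult_left_mono) auto
  have t_0 [simp]: "t n 0 = 0" and t_last [simp]: "t n (Suc n) = T" for n
    by (simp_all add: t_def)
  have t_mem: "t n i \<in> {0..T}" if "i \<le> Suc n" for n i
    using t_mono[of 0 i n] t_mono[of i "Suc n" n] that by simp
  have sp: "space (F s) = space M" if "s \<in> {0..T}" for s
    using sub[OF that] by (simp add: subalgebra_def)
  have \<psi>_M: "\<psi> s \<in> borel_measurable M" if "s \<in> {0..T}" for s
    using \<psi>_adapted[OF that] sub[OF that] by (rule measurable_from_subalg[rotated])
  have \<psi>_F: "\<psi> s \<in> borel_measurable (F u)" if "0 \<le> s" "s \<le> u" "u \<le> T" for s u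
    using \<psi>_adapted[of s] that mono[of s u] sp[of s] sp[of u]
    by (intro measurable_from_subalg[of "F u" "F s"]) (auto simp: subalgebra_def)
  have b_ind: "(\<lambda>\<omega>. \<integral>\<^sup>+ s\<in>{u<..v}. b s \<omega> \<partial>lborel) \<in> borel_measurable M" if "0 \<le> u" "v \<le> T" for u v
  proof -
    have "(\<lambda>x. (\<lambda>(\<omega>, s). b s \<omega> * indicator {0..T} s) x * indicator {u<..v} (snd x))
        \<in> borel_measurable (M \<Otimes>\<^sub>M lborel)"
      using b by measurable
    then have "(\<lambda>(\<omega>, s). b s \<omega> * indicator {u<..v} s) \<in> borel_measurable (M \<Otimes>\<^sub>M lborel)"
      by (rule measurable_cong[THEN iffD1, rotated]) (use that in \<open>auto simp: indicator_def\<close>)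
    then show ?thesis by (rule lborel.borel_measurable_nn_integral)
  qed
  have b_s: "(\<lambda>s. b s \<omega> * indicator {0..T} s) \<in> borel_measurable lborel" if "\<omega> \<in> space M" for \<omega>
    using measurable_compose[OF measurable_Pair1'[OF that, of lborel] b] by simp
  have b_s': "(\<lambda>s. b s \<omega> * indicator {u<..v} s) \<in> borel_measurable lborel"
    if "\<omega> \<in> space M" "0 \<le> u" "v \<le> T" for \<omega> u v
  proof -
    have "(\<lambda>s. (b s \<omega> * indicator {0..T} s) * indicator {u<..v} s) \<in> borel_measurable lborel"
      using b_s[OF that(1)] by measurable
    then show ?thesis
      by (rule measurable_cong[THEN iffD1, rotated]) (use that in \<open>auto simp: indicator_def\<close>)
  qed
  define J where "J n \<omega> = (\<Sum>i<Suc n. \<psi> (t n i) \<omega> * (\<integral>\<^sup>+ s\<in>{t n i<..t n (Suc i)}. b s \<omega> \<partial>lborel))" for n \<omega>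
  have J_M [measurable]: "J n \<in> borel_measurable M" for n
  proof -
    have "(\<lambda>\<omega>. \<psi> (t n i) \<omega> * (\<integral>\<^sup>+ s\<in>{t n i<..t n (Suc i)}. b s \<omega> \<partial>lborel)) \<in> borel_measurable M"
      if "i < Suc n" for i
      using that t_mem[of i n] t_mem[of "Suc i" n]
      by (intro borel_measurable_times_ennreal \<psi>_M b_ind) auto
    then show ?thesis unfolding J_def by (intro borel_measurable_sum) auto
  qed
  have J_le: "(\<integral>\<^sup>+ \<omega>. J n \<omega> \<partial>M) \<le> K * (\<integral>\<^sup>+ \<omega>. \<psi> T \<omega> \<partial>M)" for n
  proof -
    \<comment> \<open>Freezing the grid at \<open>T\<close> after its last point makes the
      measurability conditions of the discrete lemma hold for all indices.\<close>
    let ?t = "\<lambda>i. t n (min i (Suc n))"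
    let ?R = "\<lambda>i \<omega>. \<integral>\<^sup>+ s\<in>{?t i<..T}. b s \<omega> \<partial>lborel"
    let ?\<beta> = "\<lambda>i \<omega>. \<integral>\<^sup>+ s\<in>{?t i<..?t (Suc i)}. b s \<omega> \<partial>lborel"
    have t: "?t i \<in> {0..T}" for i by (rule t_mem) simp
    have R_bound: "(\<integral>\<^sup>+ \<omega>. f \<omega> * ?R i \<omega> \<partial>M) \<le> K * (\<integral>\<^sup>+ \<omega>. f \<omega> \<partial>M)"
      if "f \<in> borel_measurable (F (?t i))" for f i
    proof -
      have "(\<integral>\<^sup>+ \<omega>. f \<omega> * ?R i \<omega> \<partial>M) \<le> (\<integral>\<^sup>+ \<omega>. f \<omega> * (\<integral>\<^sup>+ s\<in>{?t i..T}. b s \<omega> \<partial>lborel) \<partial>M)"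
        by (intro nn_integral_mono mult_left_mono) (auto simp: indicator_def)
      also have "\<dots> \<le> K * (\<integral>\<^sup>+ \<omega>. f \<omega> \<partial>M)" by (rule bound[OF t that])
      finally show ?thesis .
    qed
    have "(\<integral>\<^sup>+ \<omega>. (\<Sum>i<Suc n. \<psi> (?t i) \<omega> * ?\<beta> i \<omega>) + \<psi> (?t (Suc n)) \<omega> * ?R (Suc n) \<omega> \<partial>M)
        \<le> K * (\<integral>\<^sup>+ \<omega>. \<psi> (?t (Suc n)) \<omega> \<partial>M)"
    proof (rule nn_integral_discrete_parts_le[where n = "Suc n" and R = ?R and \<beta> = ?\<beta> and \<psi> = "\<lambda>i. \<psi> (?t i)"])
      show "\<psi> (?t i) \<in> borel_measurable M" for i by (rule \<psi>_M[OF t])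
      show "?\<beta> i \<in> borel_measurable M" "?R i \<in> borel_measurable M" for i
        using t[of i] t[of "Suc i"] by (auto intro!: b_ind)
      show "?R i \<omega> = ?\<beta> i \<omega> + ?R (Suc i) \<omega>" if "i < Suc n" "\<omega> \<in> space M" for i \<omega>
      proof -
        have "?t i \<le> ?t (Suc i)" "?t (Suc i) \<le> T" "0 \<le> ?t i"
          using t[of i] t[of "Suc i"] by (auto intro!: t_mono)
        then have "?R i \<omega> = (\<integral>\<^sup>+ s. b s \<omega> * indicator {?t i<..?t (Suc i)} s
            + b s \<omega> * indicator {?t (Suc i)<..T} s \<partial>lborel)"
          by (intro nn_integral_cong) (auto simp: indicator_def)
        also have "\<dots> = ?\<beta> i \<omega> + ?R (Suc i) \<omega>"
          using that t[of i] t[of "Suc i"] by (intro nn_integral_add b_s') auto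
        finally show ?thesis .
      qed
      show "\<psi> (?t i) \<omega> \<le> \<psi> (?t (Suc i)) \<omega>" if "i < Suc n" "\<omega> \<in> space M" for i \<omega>
        using t[of i] t[of "Suc i"] that by (intro \<psi>_mono t_mono) auto
      show "(\<integral>\<^sup>+ \<omega>. \<psi> (?t 0) \<omega> * ?R 0 \<omega> \<partial>M) \<le> K * (\<integral>\<^sup>+ \<omega>. \<psi> (?t 0) \<omega> \<partial>M)"
        by (rule R_bound) (rule \<psi>_adapted[OF t])
      show "(\<integral>\<^sup>+ \<omega>. (\<psi> (?t (Suc i)) \<omega> - \<psi> (?t i) \<omega>) * ?R (Suc i) \<omega> \<partial>M)
          \<le> K * (\<integral>\<^sup>+ \<omega>. \<psi> (?t (Suc i)) \<omega> - \<psi> (?t i) \<omega> \<partial>M)" for i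
        using t[of i] t[of "Suc i"]
        by (intro R_bound borel_measurable_minus_ennreal \<psi>_F t_mono) auto
    qed simp
    moreover have "J n \<omega> = (\<Sum>i<Suc n. \<psi> (?t i) \<omega> * ?\<beta> i \<omega>)" for \<omega>
      unfolding J_def by (intro sum.cong) (auto simp: min_def)
    ultimately show ?thesis by (simp del: sum.lessThan_Suc)
  qed
  have inner: "(\<integral>\<^sup>+ s\<in>{0..T}. \<psi> s \<omega> * b s \<omega> \<partial>lborel) \<le> liminf (\<lambda>n. J n \<omega>)"
    if \<omega>: "\<omega> \<in> space M" and left: "\<forall>t\<in>{0<..T}. ((\<lambda>s. \<psi> s \<omega>) \<longlongrightarrow> \<psi> t \<omega>) (at_left t)" for \<omega>
  proof -
    define G where "G n s = (\<Sum>i<Suc n. \<psi> (t n i) \<omega> * (b s \<omega> * indicator {t n i<..t n (Suc i)} s))" for n s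
    have meas: "(\<lambda>s. b s \<omega> * indicator {t n i<..t n (Suc i)} s) \<in> borel_measurable lborel"
      if "i < Suc n" for n i
      using that t_mem[of i n] t_mem[of "Suc i" n] \<omega> by (intro b_s') auto
    have G_meas: "G n \<in> borel_measurable lborel" for n
      unfolding G_def
      by (rule borel_measurable_sum) (rule borel_measurable_times_ennreal[OF borel_measurable_const meas], simp)
    have GJ: "(\<integral>\<^sup>+ s. G n s \<partial>lborel) = J n \<omega>" for n
    proof -
      have "(\<integral>\<^sup>+ s. G n s \<partial>lborel)
          = (\<Sum>i<Suc n. \<integral>\<^sup>+ s. \<psi> (t n i) \<omega> * (b s \<omega> * indicator {t n i<..t n (Suc i)} s) \<partial>lborel)"
        unfolding G_def
        by (rule nn_integral_sum) (rule borel_measurable_times_ennreal[OF borel_measurable_const meas], simp)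
      also have "\<dots> = J n \<omega>"
        unfolding J_def by (rule sum.cong[OF refl]) (rule nn_integral_cmult[OF meas], simp)
      finally show ?thesis .
    qed
    have "(\<integral>\<^sup>+ s\<in>{0..T}. \<psi> s \<omega> * b s \<omega> \<partial>lborel) \<le> (\<integral>\<^sup>+ s. liminf (\<lambda>n. G n s) \<partial>lborel)"
    proof (rule nn_integral_mono_AE)
      show "AE s in lborel. \<psi> s \<omega> * b s \<omega> * indicator {0..T} s \<le> liminf (\<lambda>n. G n s)"
        \<comment> \<open>No left-open cell contains the time 0, which is a null set.\<close>
        using AE_lborel_singleton[of 0]
      proof eventually_elim
        fix s :: real assume "s \<noteq> 0"
        show "\<psi> s \<omega> * b s \<omega> * indicator {0..T} s \<le> liminf (\<lambda>n. G n s)"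
        proof (cases "s \<in> {0..T}")
          case True
          with \<open>s \<noteq> 0\<close> have s: "0 < s" "s \<le> T" by auto
          \<comment> \<open>The factor \<open>b s \<omega>\<close> is finite, so multiplication by
            it is continuous on \<open>ennreal\<close>.\<close>
          have "(\<lambda>n. b s \<omega> * (\<Sum>i<Suc n. \<psi> (t n i) \<omega> * indicator {t n i<..t n (Suc i)} s))
              \<longlonglongrightarrow> b s \<omega> * \<psi> s \<omega>"
            unfolding t_def using left s b_fin
            by (intro ennreal_tendsto_cmult step_function_tendsto_at_left[OF T s, of "\<lambda>s. \<psi> s \<omega>"]) auto
          then have "(\<lambda>n. G n s) \<longlonglongrightarrow> b s \<omega> * \<psi> s \<omega>"
            unfolding G_def sum_distrib_left by (simp only: mult_ac)
          then have "liminf (\<lambda>n. G n s) = b s \<omega> * \<psi> s \<omega>"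
            by (rule lim_imp_Liminf[rotated]) simp
          then show ?thesis using True by (simp add: mult.commute)
        qed simp
      qed
    qed
    also have "\<dots> \<le> liminf (\<lambda>n. \<integral>\<^sup>+ s. G n s \<partial>lborel)"
      by (rule nn_integral_liminf[OF G_meas])
    finally show ?thesis unfolding GJ .
  qed
  have "(\<integral>\<^sup>+ \<omega>. (\<integral>\<^sup>+ s\<in>{0..T}. \<psi> s \<omega> * b s \<omega> \<partial>lborel) \<partial>M) \<le> (\<integral>\<^sup>+ \<omega>. liminf (\<lambda>n. J n \<omega>) \<partial>M)"
  proof (rule nn_integral_mono_AE)
    show "AE \<omega> in M. (\<integral>\<^sup>+ s\<in>{0..T}. \<psi> s \<omega> * b s \<omega> \<partial>lborel) \<le> liminf (\<lambda>n. J n \<omega>)"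
      using \<psi>_left AE_space by eventually_elim (rule inner)
  qed
  also have "\<dots> \<le> liminf (\<lambda>n. \<integral>\<^sup>+ \<omega>. J n \<omega> \<partial>M)"
    by (rule nn_integral_liminf) measurable
  also have "\<dots> \<le> K * (\<integral>\<^sup>+ \<omega>. \<psi> T \<omega> \<partial>M)"
    using J_le by (intro Liminf_le) (auto intro!: always_eventually)
  finally show ?thesis .
qed

section \<open>Powers of extended nonnegative reals\<close>

lemma ennpowr_ennreal: "0 \<le> x \<Longrightarrow> ennpowr (ennreal x) a = ennreal (x powr a)"
  by (simp add: ennpowr_def)

lemma ennpowr_top [simp]: "ennpowr \<top> a = \<top>"
  by (simp add: ennpowr_def)

lemma ennpowr_0 [simp]: "ennpowr 0 a = 0"
  by (simp add: ennpowr_def)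

lemma ennpowr_1 [simp]: "ennpowr x 1 = x"
  by (cases x) (auto simp: ennpowr_ennreal)

lemma ennpowr_2: "ennpowr x 2 = x\<^sup>2"
  by (cases x) (auto simp: ennpowr_ennreal ennreal_power power2_eq_square[of "\<top>"] ennreal_top_mult)

lemma ennpowr_less_top_iff [simp]: "ennpowr x a < \<top> \<longleftrightarrow> x < \<top>"
  by (cases x) (auto simp: ennpowr_ennreal)

lemma ennpowr_eq_0_iff [simp]: "ennpowr x a = 0 \<longleftrightarrow> x = 0"
  by (cases x) (auto simp: ennpowr_ennreal)

lemma ennpowr_mono: "x \<le> y \<Longrightarrow> 0 \<le> a \<Longrightarrow> ennpowr x a \<le> ennpowr y a"
  by (cases x; cases y) (auto simp: ennpowr_ennreal top_unique intro!: ennreal_leI powr_mono2)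

lemma ennpowr_mult: "ennpowr (x * y) a = ennpowr x a * ennpowr y a"
proof (cases "x = \<top> \<or> y = \<top>")
  case True
  then show ?thesis
    by (cases "x = 0 \<or> y = 0") (auto simp: ennreal_mult_top ennreal_top_mult)
next
  case False
  then show ?thesis
    by (cases x; cases y) (auto simp: ennpowr_ennreal powr_mult simp flip: ennreal_mult)
qed

lemma ennpowr_ennpowr: "ennpowr (ennpowr x a) b = ennpowr x (a * b)"
  by (cases x) (auto simp: ennpowr_ennreal powr_powr)

lemma measurable_ennpowr [measurable]: "(\<lambda>x. ennpowr x a) \<in> borel_measurable borel"
  unfolding ennpowr_def by measurable

lemma tendsto_ennpowr:
  assumes f: "(f \<longlongrightarrow> x) F" and "x < \<top>" "0 < a"
  shows "((\<lambda>s. ennpowr (f s) a) \<longlongrightarrow> ennpowr x a) F"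
proof -
  have "((\<lambda>s. enn2real (f s)) \<longlongrightarrow> enn2real x) F"
    using assms by (intro tendsto_enn2real) (auto simp: ennreal_enn2real)
  then have "((\<lambda>s. enn2real (f s) powr a) \<longlongrightarrow> enn2real x powr a) F"
    using \<open>0 < a\<close> by (intro tendsto_powr2 tendsto_const) auto
  then have "((\<lambda>s. ennreal (enn2real (f s) powr a)) \<longlongrightarrow> ennpowr x a) F"
    using \<open>x < \<top>\<close> by (auto simp: ennpowr_def intro!: tendsto_ennrealI)
  moreover have "eventually (\<lambda>s. ennreal (enn2real (f s) powr a) = ennpowr (f s) a) F"
    using order_tendstoD(2)[OF f \<open>x < \<top>\<close>] by eventually_elim (auto simp: ennpowr_def)
  ultimately show ?thesis by (rule Lim_transform_eventually)
qed

section \<open>Pathwise continuity, Young's inequality and a weighted Cauchy--Schwarz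
  inequality\<close>

lemma progressive_nn_path:
  assumes "progressive_nn F T X" "0 \<le> T" "\<omega> \<in> space (F T)"
  shows "(\<lambda>s. X s \<omega> * indicator {0..T} s) \<in> borel_measurable borel"
  using measurable_compose[OF measurable_Pair1'[OF assms(3), of lborel] progressive_nn_joint[OF assms(1), of T]] assms(2)
  by simp

text \<open>On \<open>{0..T}\<close> the cumulative integral coincides with the continuous function
  \<open>C\<close> from the change of variables.\<close>

lemma tendsto_cumulative_integral_at_left:
  fixes g :: "real \<Rightarrow> ennreal" and T :: real
  assumes meas: "(\<lambda>s. g s * indicator {0..T} s) \<in> borel_measurable borel"
    and fin: "(\<integral>\<^sup>+ s\<in>{0..T}. g s \<partial>lborel) < \<infinity>" and t: "t \<in> {0<..T}"
  shows "((\<lambda>s. \<integral>\<^sup>+ u\<in>{0..s}. g u \<partial>lborel) \<longlongrightarrow> (\<integral>\<^sup>+ u\<in>{0..t}. g u \<partial>lborel)) (at_left t)"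
proof -
  have eq: "(\<integral>\<^sup>+ u\<in>{0..s}. g u * indicator {0..T} u \<partial>lborel) = (\<integral>\<^sup>+ u\<in>{0..s}. g u \<partial>lborel)"
    if "s \<le> T" for s
    using that by (intro nn_integral_cong) (auto simp: indicator_def)
  have fin': "(\<integral>\<^sup>+ s\<in>{0..T}. g s * indicator {0..T} s \<partial>lborel) < \<infinity>"
    using fin eq[of T] by simp
  from t have "0 \<le> T" by simp
  obtain C :: "real \<Rightarrow> real" where C: "continuous_on UNIV C" "mono C" "\<And>s. 0 \<le> C s"
    and C_eq: "\<And>s. s \<in> {0..T} \<Longrightarrow> (\<integral>\<^sup>+ u\<in>{0..s}. g u * indicator {0..T} u \<partial>lborel) = ennreal (C s)"
    and "\<And>h. h \<in> borel_measurable borel \<Longrightarrow>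
      (\<integral>\<^sup>+ s\<in>{0..T}. h (C s) * (g s * indicator {0..T} s) \<partial>lborel) = (\<integral>\<^sup>+ x\<in>{0..C T}. h x \<partial>lborel)"
    by (rule cumulative_integral_change_of_variables[OF meas \<open>0 \<le> T\<close> fin']) (rule that)
  have "(C \<longlongrightarrow> C t) (at_left t)"
    using C(1) by (meson UNIV_I continuous_on_def subset_UNIV tendsto_within_subset)
  then have "((\<lambda>s. ennreal (C s)) \<longlongrightarrow> ennreal (C t)) (at_left t)"
    by (rule tendsto_ennrealI)
  moreover have "eventually (\<lambda>s. ennreal (C s) = (\<integral>\<^sup>+ u\<in>{0..s}. g u \<partial>lborel)) (at_left t)"
    using eventually_at_left_real[of 0 t] t C_eq eq by (auto elim!: eventually_mono)
  moreover have "ennreal (C t) = (\<integral>\<^sup>+ u\<in>{0..t}. g u \<partial>lborel)"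
    using t eq[of t] C_eq[of t] by simp
  ultimately show ?thesis by (simp add: Lim_transform_eventually)
qed

text \<open>Young's inequality with exponent \<open>p\<close> on \<open>y\<close> and the conjugate
  exponent \<open>p / (p - 1)\<close> on \<open>x powr (p - 1)\<close>. The coefficient
  \<open>1 - 1 / p\<close> is below 1, which later allows the first term to be absorbed.\<close>

lemma Youngs_inequality_powr_minus_1:
  fixes p x y :: real
  assumes "1 < p" "0 \<le> x" "0 \<le> y"
  shows "x powr (p - 1) * y \<le> (1 - 1 / p) * x powr p + y powr p / p"
proof -
  have "y * x powr (p - 1) \<le> y powr p / p + (x powr (p - 1)) powr (p / (p - 1)) / (p / (p - 1))"
    using assms by (intro Youngs_inequality) (auto simp: field_simps)
  also have "(x powr (p - 1)) powr (p / (p - 1)) = x powr p"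
    using assms by (simp add: powr_powr)
  also have "x powr p / (p / (p - 1)) = (1 - 1 / p) * x powr p"
    using assms by (simp add: field_simps)
  finally show ?thesis by (simp add: mult.commute add.commute)
qed

text \<open>Cauchy--Schwarz for the splitting of the integrand into \<open>a \<alpha> powr (-1/4)\<close> and \<open>b \<alpha> powr (1/4)\<close>.\<close>
lemma weighted_Cauchy_Schwarz_cumulative:
  fixes a b :: "real \<Rightarrow> ennreal" and T :: real
  defines "\<alpha> \<equiv> \<lambda>s. \<integral>\<^sup>+ u\<in>{0..s}. (a u)\<^sup>2 \<partial>lborel"
  assumes T: "0 \<le> T"
    and a [measurable]: "(\<lambda>s. a s * indicator {0..T} s) \<in> borel_measurable borel"
    and b [measurable]: "(\<lambda>s. b s * indicator {0..T} s) \<in> borel_measurable borel"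
    and fin: "\<alpha> T < \<infinity>"
  shows "(\<integral>\<^sup>+ s\<in>{0..T}. a s * b s \<partial>lborel)\<^sup>2
    \<le> 2 * ennpowr (\<alpha> T) (1/2) * (\<integral>\<^sup>+ s\<in>{0..T}. ennpowr (\<alpha> s) (1/2) * (b s)\<^sup>2 \<partial>lborel)"
proof -
  let ?I = "indicator {0..T} :: real \<Rightarrow> ennreal"
  have sq: "(a s * ?I s)\<^sup>2 = (a s)\<^sup>2 * ?I s" for s
    by (simp add: indicator_def)
  have eq: "(\<integral>\<^sup>+ u\<in>{0..s}. (a u * ?I u)\<^sup>2 \<partial>lborel) = \<alpha> s" if "s \<le> T" for s
    unfolding \<alpha>_def using that by (intro nn_integral_cong) (auto simp: indicator_def)
  have g_fin: "(\<integral>\<^sup>+ s\<in>{0..T}. (a s * ?I s)\<^sup>2 \<partial>lborel) < \<infinity>"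
    using fin eq[of T] by simp
  have g_meas: "(\<lambda>s. (a s * ?I s)\<^sup>2) \<in> borel_measurable borel"
    by measurable
  obtain C :: "real \<Rightarrow> real" where cont: "continuous_on UNIV C" and "mono C" and C0: "\<And>s. 0 \<le> C s"
    and C_eq: "\<And>s. s \<in> {0..T} \<Longrightarrow> (\<integral>\<^sup>+ u\<in>{0..s}. (a u * ?I u)\<^sup>2 \<partial>lborel) = ennreal (C s)"
    and cv: "\<And>h. h \<in> borel_measurable borel \<Longrightarrow>
      (\<integral>\<^sup>+ s\<in>{0..T}. h (C s) * (a s * ?I s)\<^sup>2 \<partial>lborel) = (\<integral>\<^sup>+ x\<in>{0..C T}. h x \<partial>lborel)"
    by (rule cumulative_integral_change_of_variables[OF g_meas T g_fin]) (rule that)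
  have \<alpha>C: "\<alpha> s = ennreal (C s)" if "s \<in> {0..T}" for s
    using C_eq[OF that] eq[of s] that by simp
  have [measurable]: "C \<in> borel_measurable borel"
    using cont by (rule borel_measurable_continuous_onI)
  define f where "f s = a s * ?I s * ennreal (C s powr (-1/4))" for s
  define g where "g s = b s * ?I s * ennreal (C s powr (1/4))" for s
  have [measurable]: "f \<in> borel_measurable lborel" "g \<in> borel_measurable lborel"
    unfolding f_def g_def by measurable
  have f2: "(\<integral>\<^sup>+ s. (f s)\<^sup>2 \<partial>lborel) = 2 * ennpowr (\<alpha> T) (1/2)"
  proof -
    have "(\<integral>\<^sup>+ s. (f s)\<^sup>2 \<partial>lborel) = (\<integral>\<^sup>+ s\<in>{0..T}. ennreal (C s powr (-1/2)) * (a s * ?I s)\<^sup>2 \<partial>lborel)"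
    proof (intro nn_integral_cong)
      fix s
      have "(C s powr (-1/4))\<^sup>2 = C s powr (-1/2)"
        by (simp add: power2_eq_square flip: powr_add)
      then show "(f s)\<^sup>2 = ennreal (C s powr (-1/2)) * (a s * ?I s)\<^sup>2 * ?I s"
        by (auto simp: f_def power_mult_distrib indicator_def ennreal_power mult.commute)
    qed
    \<comment> \<open>Substituting \<open>x = C s\<close> leaves the integral of
      \<open>x powr (-1/2)\<close> over \<open>{0..C T}\<close>, which is twice the square root of
      \<open>C T\<close>.\<close>
    also have "\<dots> = (\<integral>\<^sup>+ x\<in>{0..C T}. ennreal (x powr (-1/2)) \<partial>lborel)"
      by (rule cv) measurable
    also have "\<dots> = ennreal (C T powr (1/2) / (1/2))"
      using nn_integral_powr_from_0[of "-1/2" "C T"] C0 by simp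
    also have "\<dots> = 2 * ennpowr (\<alpha> T) (1/2)"
      using T C0 by (simp add: \<alpha>C ennpowr_ennreal ennreal_mult mult.commute)
    finally show ?thesis .
  qed
  have g2: "(\<integral>\<^sup>+ s. (g s)\<^sup>2 \<partial>lborel) = (\<integral>\<^sup>+ s\<in>{0..T}. ennpowr (\<alpha> s) (1/2) * (b s)\<^sup>2 \<partial>lborel)"
  proof (intro nn_integral_cong)
    fix s
    have "(C s powr (1/4))\<^sup>2 = C s powr (1/2)"
      by (simp add: power2_eq_square flip: powr_add)
    then show "(g s)\<^sup>2 = ennpowr (\<alpha> s) (1/2) * (b s)\<^sup>2 * ?I s"
      using C0 by (auto simp: g_def power_mult_distrib indicator_def ennreal_power \<alpha>C ennpowr_ennreal mult.commute)
  qed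
  \<comment> \<open>Since \<open>0 powr (-1/4)\<close> is 0, the product \<open>f * g\<close> is 0
    wherever \<open>C\<close> vanishes. The change of variables for the indicator of
    \<open>{0}\<close> shows that \<open>a\<close> is also 0 there, up to a null set of
    times.\<close>
  have "(\<integral>\<^sup>+ s\<in>{0..T}. indicator {0} (C s) * (a s * ?I s)\<^sup>2 \<partial>lborel) = (\<integral>\<^sup>+ x\<in>{0..C T}. indicator {0} x \<partial>lborel)"
    by (rule cv) measurable
  also have "\<dots> = 0"
    using AE_lborel_singleton[of "0::real"]
    by (subst nn_integral_0_iff_AE) (auto elim: eventually_mono)
  finally have "AE s in lborel. indicator {0} (C s) * (a s * ?I s)\<^sup>2 * ?I s = 0"
    by (subst (asm) nn_integral_0_iff_AE) auto
  then have "(\<integral>\<^sup>+ s\<in>{0..T}. a s * b s \<partial>lborel) = (\<integral>\<^sup>+ s. f s * g s \<partial>lborel)"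
  proof (intro nn_integral_cong_AE, eventually_elim)
    fix s assume *: "indicator {0} (C s) * (a s * ?I s)\<^sup>2 * ?I s = 0"
    show "a s * b s * ?I s = f s * g s"
    proof (cases "s \<in> {0..T} \<and> a s \<noteq> 0")
      case True
      with * have "C s \<noteq> 0" by (auto simp: indicator_def split: if_splits)
      then have "ennreal (C s powr (-1/4)) * ennreal (C s powr (1/4)) = 1"
        using C0[of s] by (simp add: powr_minus flip: ennreal_mult)
      then show ?thesis
        using True by (simp add: f_def g_def mult_ac)
    qed (auto simp: f_def g_def)
  qed
  then show ?thesis
    using Cauchy_Schwarz_nn_integral[of f lborel g] by (simp add: f2 g2)
qed

section \<open>Garsia's inequality and the upper bound\<close>

text \<open>The chain rule writes \<open>Z T ^ p\<close> as the integral of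
  \<open>\<psi> * b\<close> with \<open>\<psi> = p * Z ^ (p - 1) * \<phi>\<close> increasing and
  adapted, so the inequality for increasing integrands applies. Young's inequality then leaves a
  multiple of the left side on the right. Absorbing it requires a finite left side, so
  \<open>Z\<close> is first truncated at a level \<open>N\<close>, and monotone convergence removes
  the truncation.\<close>

lemma (in prob_space) progressive_Garsia_inequality:
  fixes \<phi> b :: "real \<Rightarrow> 'a \<Rightarrow> ennreal" and T p k :: real
  defines "Z \<equiv> \<lambda>t \<omega>. \<integral>\<^sup>+ s\<in>{0..t}. \<phi> s \<omega> * b s \<omega> \<partial>lborel"
  assumes T: "0 < T" and p: "1 \<le> p" and k: "0 \<le> k"
    and sub: "\<And>t. t \<in> {0..T} \<Longrightarrow> subalgebra M (F t)"
    and mono: "\<And>s t. 0 \<le> s \<Longrightarrow> s \<le> t \<Longrightarrow> t \<le> T \<Longrightarrow> sets (F s) \<subseteq> sets (F t)"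
    and b: "progressive_nn F T b" and b_fin: "\<And>s \<omega>. b s \<omega> < \<infinity>"
    and bound: "\<And>t f. t \<in> {0..T} \<Longrightarrow> f \<in> borel_measurable (F t) \<Longrightarrow>
      (\<integral>\<^sup>+ \<omega>. f \<omega> * (\<integral>\<^sup>+ s\<in>{t..T}. b s \<omega> \<partial>lborel) \<partial>M) \<le> ennreal k * (\<integral>\<^sup>+ \<omega>. f \<omega> \<partial>M)"
    and \<phi>: "progressive_nn F T \<phi>"
    and \<phi>_mono: "\<And>s t \<omega>. 0 \<le> s \<Longrightarrow> s \<le> t \<Longrightarrow> t \<le> T \<Longrightarrow> \<omega> \<in> space M \<Longrightarrow> \<phi> s \<omega> \<le> \<phi> t \<omega>"
    and \<phi>_left: "AE \<omega> in M. \<forall>t\<in>{0<..T}. ((\<lambda>s. \<phi> s \<omega>) \<longlongrightarrow> \<phi> t \<omega>) (at_left t)"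
    and \<phi>_fin: "(\<integral>\<^sup>+ \<omega>. ennpowr (\<phi> T \<omega>) p \<partial>M) < \<infinity>"
  shows "(\<integral>\<^sup>+ \<omega>. ennpowr (Z T \<omega>) p \<partial>M) \<le> ennpowr (p * k) p * (\<integral>\<^sup>+ \<omega>. ennpowr (\<phi> T \<omega>) p \<partial>M)"
proof -
  have T': "T \<in> {0..T}" using T by simp
  have sp: "space (F s) = space M" if "s \<in> {0..T}" for s
    using sub[OF that] by (simp add: subalgebra_def)
  have from_F: "f \<in> borel_measurable M" if "f \<in> borel_measurable (F t)" "t \<in> {0..T}"
    for f :: "'a \<Rightarrow> ennreal" and t
    using sub[OF that(2)] that(1) by (rule measurable_from_subalg)
  have \<phi>b: "progressive_nn F T (\<lambda>s \<omega>. \<phi> s \<omega> * b s \<omega>)"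
    using \<phi> b by (rule progressive_nn_mult)
  have Z: "progressive_nn F T Z"
    unfolding Z_def using \<phi>b by (rule progressive_nn_integral)
  have Z_M [measurable]: "Z T \<in> borel_measurable M" and \<phi>_M [measurable]: "\<phi> T \<in> borel_measurable M"
    by (rule from_F[OF progressive_nn_section[OF Z T'] T'], rule from_F[OF progressive_nn_section[OF \<phi> T'] T'])
  have b_joint: "(\<lambda>(\<omega>, s). b s \<omega> * indicator {0..T} s) \<in> borel_measurable (M \<Otimes>\<^sub>M lborel)"
  proof -
    have "(\<lambda>x. x) \<in> M \<rightarrow>\<^sub>M F T"
      using sub[OF T'] by (auto simp: measurable_def subalgebra_def Int_absorb2 sets.sets_into_space)
    then have "(\<lambda>x. (fst x, snd x)) \<in> M \<Otimes>\<^sub>M (lborel :: real measure) \<rightarrow>\<^sub>M F T \<Otimes>\<^sub>M lborel"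
      by (intro measurable_Pair measurable_compose[OF measurable_fst] measurable_snd)
    then show ?thesis
      using measurable_compose[OF _ progressive_nn_joint[OF b T']] by simp
  qed
  note key = nn_integral_increasing_adapted_le[OF T sub mono b_joint b_fin bound]
  have EZ: "(\<integral>\<^sup>+ \<omega>. Z T \<omega> \<partial>M) \<le> ennreal k * (\<integral>\<^sup>+ \<omega>. \<phi> T \<omega> \<partial>M)"
    unfolding Z_def
    by (rule key[where \<psi> = \<phi>]) (use progressive_nn_section[OF \<phi>] \<phi>_mono \<phi>_left in auto)
  show ?thesis
  proof (cases "p = 1")
    \<comment> \<open>For \<open>p = 1\<close> the inequality for increasing integrands with
      \<open>\<psi> = \<phi>\<close> is already the claim.\<close>
    case True
    then show ?thesis using EZ k by simp
  next
    case False
    with p have p: "1 < p" by simp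
    \<comment> \<open>A finite \<open>p\<close>-th moment of \<open>\<phi> T\<close> gives a finite
      first moment. Through \<open>EZ\<close> this makes \<open>Z T\<close> finite almost
      everywhere, as the pathwise substitution requires.\<close>
    have "x \<le> 1 + ennpowr x p" for x
    proof (cases x)
      case (real r)
      have "r \<le> 1 + r powr p"
      proof (cases "r \<le> 1")
        case True
        then show ?thesis using powr_ge_zero[of r p] by linarith
      next
        case False
        then show ?thesis using p powr_mono[of 1 p r] by simp
      qed
      then show ?thesis using real by (simp add: ennpowr_ennreal flip: ennreal_1 ennreal_plus)
    qed simp
    then have "(\<integral>\<^sup>+ \<omega>. \<phi> T \<omega> \<partial>M) \<le> (\<integral>\<^sup>+ \<omega>. 1 + ennpowr (\<phi> T \<omega>) p \<partial>M)"
      by (intro nn_integral_mono) auto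
    also have "\<dots> < \<infinity>"
      using \<phi>_fin by (subst nn_integral_add) (auto simp: emeasure_space_1)
    finally have E\<phi>: "(\<integral>\<^sup>+ \<omega>. \<phi> T \<omega> \<partial>M) < \<infinity>" .
    then have \<phi>_AE: "AE \<omega> in M. \<phi> T \<omega> \<noteq> \<infinity>"
      by (intro nn_integral_PInf_AE) auto
    have "(\<integral>\<^sup>+ \<omega>. Z T \<omega> \<partial>M) < \<infinity>"
      using EZ E\<phi> by (auto simp: ennreal_mult_less_top intro: le_less_trans)
    then have Z_AE: "AE \<omega> in M. Z T \<omega> \<noteq> \<infinity>"
      by (intro nn_integral_PInf_AE) auto
    define R where "R = ennpowr (p * k) p * (\<integral>\<^sup>+ \<omega>. ennpowr (\<phi> T \<omega>) p \<partial>M)"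
    have R_fin: "R < \<infinity>"
      using \<phi>_fin p k by (auto simp: R_def ennreal_mult_less_top)
    have R_eq: "R = (\<integral>\<^sup>+ \<omega>. ennpowr (ennreal (p * k) * \<phi> T \<omega>) p \<partial>M)"
      unfolding R_def ennpowr_mult by (rule nn_integral_cmult[symmetric]) measurable
    have trunc: "(\<integral>\<^sup>+ \<omega>. ennpowr (min (Z T \<omega>) (of_nat N)) p \<partial>M) \<le> R" for N :: nat
    proof -
      \<comment> \<open>Beyond the level \<open>N\<close> the factor stays at
        \<open>N ^ (p - 1)\<close> rather than dropping to the derivative 0 of the truncated power.
        This keeps \<open>\<psi>\<close> increasing, at the price of an inequality instead of an
        equality in \<open>path\<close>.\<close>
      define \<psi> where "\<psi> t \<omega> = ennreal p * ennpowr (min (Z t \<omega>) (of_nat N)) (p - 1) * \<phi> t \<omega>" for t \<omega>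
      have min_top: "min x (of_nat N) < (\<top> :: ennreal)" for x
        by (simp add: min_less_iff_disj ennreal_of_nat_eq_real_of_nat)
      let ?L = "\<integral>\<^sup>+ \<omega>. ennpowr (min (Z T \<omega>) (of_nat N)) p \<partial>M"
      have \<psi>: "progressive_nn F T \<psi>"
        unfolding \<psi>_def
        by (intro progressive_nn_mult \<phi> progressive_nn_compose[OF Z]) measurable
      have path: "ennpowr (min (Z T \<omega>) (of_nat N)) p \<le> (\<integral>\<^sup>+ s\<in>{0..T}. \<psi> s \<omega> * b s \<omega> \<partial>lborel)"
        if \<omega>: "\<omega> \<in> space M" and fin: "Z T \<omega> \<noteq> \<infinity>" for \<omega>
      proof -
        let ?I = "indicator {0..T} :: real \<Rightarrow> ennreal"
        let ?g = "\<lambda>s. \<phi> s \<omega> * b s \<omega> * ?I s"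
        have g: "?g \<in> borel_measurable borel"
          using progressive_nn_path[OF \<phi>b, of \<omega>] T \<omega> sp[OF T'] by simp
        have eq: "(\<integral>\<^sup>+ u\<in>{0..s}. ?g u \<partial>lborel) = Z s \<omega>" if "s \<le> T" for s
          unfolding Z_def using that by (intro nn_integral_cong) (auto simp: indicator_def)
        have g_fin: "(\<integral>\<^sup>+ s\<in>{0..T}. ?g s \<partial>lborel) < \<infinity>"
          using eq[of T] fin by (simp add: less_top)
        obtain C :: "real \<Rightarrow> real" where cont: "continuous_on UNIV C" and "mono C" and C0: "\<And>s. 0 \<le> C s"
          and C_eq: "\<And>s. s \<in> {0..T} \<Longrightarrow> (\<integral>\<^sup>+ u\<in>{0..s}. ?g u \<partial>lborel) = ennreal (C s)"
          and cv: "\<And>h. h \<in> borel_measurable borel \<Longrightarrow>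
            (\<integral>\<^sup>+ s\<in>{0..T}. h (C s) * ?g s \<partial>lborel) = (\<integral>\<^sup>+ x\<in>{0..C T}. h x \<partial>lborel)"
          by (rule cumulative_integral_change_of_variables[OF g less_imp_le[OF T] g_fin]) (rule that)
        have ZC: "Z s \<omega> = ennreal (C s)" if "s \<in> {0..T}" for s
          using C_eq[OF that] eq[of s] that by simp
        have min_eq: "min (ennreal (C s)) (of_nat N) = ennreal (min (C s) (real N))" for s
          by (simp add: ennreal_of_nat_eq_real_of_nat min_ennreal C0)
        define h where "h x = ennreal p * ennreal (min x (real N) powr (p - 1))" for x
        have [measurable]: "h \<in> borel_measurable borel"
          unfolding h_def by measurable
        have "ennpowr (min (Z T \<omega>) (of_nat N)) p = ennreal (min (C T) (real N) powr p)"
          using ZC[OF T'] C0 by (simp add: min_eq ennpowr_ennreal)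
        also have "\<dots> = ennreal p * (\<integral>\<^sup>+ x\<in>{0..min (C T) (real N)}. ennreal (x powr (p - 1)) \<partial>lborel)"
          using p C0[of T] nn_integral_powr_from_0[of "p - 1" "min (C T) (real N)"]
          by (simp flip: ennreal_mult)
        also have "\<dots> = (\<integral>\<^sup>+ x\<in>{0..min (C T) (real N)}. ennreal p * ennreal (x powr (p - 1)) \<partial>lborel)"
          by (subst nn_integral_cmult[symmetric]) (auto simp: mult.assoc)
        also have "\<dots> \<le> (\<integral>\<^sup>+ x\<in>{0..C T}. h x \<partial>lborel)"
          by (intro nn_integral_mono) (auto simp: indicator_def h_def)
        also have "\<dots> = (\<integral>\<^sup>+ s\<in>{0..T}. h (C s) * ?g s \<partial>lborel)"
          by (rule cv[symmetric]) measurable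
        also have "\<dots> = (\<integral>\<^sup>+ s\<in>{0..T}. \<psi> s \<omega> * b s \<omega> \<partial>lborel)"
        proof (intro nn_integral_cong)
          fix s
          show "h (C s) * ?g s * ?I s = \<psi> s \<omega> * b s \<omega> * ?I s"
            using C0 by (cases "s \<in> {0..T}")
              (simp_all add: h_def \<psi>_def ZC min_eq ennpowr_ennreal mult.assoc)
        qed
        finally show ?thesis .
      qed
      have Z_mono: "Z s \<omega> \<le> Z t \<omega>" if "s \<le> t" for s t \<omega>
        unfolding Z_def using that by (intro nn_integral_mono) (auto simp: indicator_def)
      have left: "AE \<omega> in M. \<forall>t\<in>{0<..T}. ((\<lambda>s. \<psi> s \<omega>) \<longlongrightarrow> \<psi> t \<omega>) (at_left t)"
        using \<phi>_left \<phi>_AE Z_AE AE_space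
      proof eventually_elim
        case (elim \<omega>)
        show ?case
        proof
          fix t assume t: "t \<in> {0<..T}"
          have "((\<lambda>s. Z s \<omega>) \<longlongrightarrow> Z t \<omega>) (at_left t)"
            unfolding Z_def
            using progressive_nn_path[OF \<phi>b, of \<omega>] T elim sp[OF T'] t
            by (intro tendsto_cumulative_integral_at_left[of _ T]) (auto simp: Z_def less_top)
          then have "((\<lambda>s. min (Z s \<omega>) (of_nat N)) \<longlongrightarrow> min (Z t \<omega>) (of_nat N)) (at_left t)"
            by (intro tendsto_min tendsto_const)
          then have 1: "((\<lambda>s. ennpowr (min (Z s \<omega>) (of_nat N)) (p - 1)) \<longlongrightarrow> ennpowr (min (Z t \<omega>) (of_nat N)) (p - 1)) (at_left t)"
            using p min_top by (intro tendsto_ennpowr) auto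
          have fin1: "ennpowr (min (Z t \<omega>) (of_nat N)) (p - 1) < \<top>"
            using min_top by simp
          have 2: "((\<lambda>s. ennreal p * ennpowr (min (Z s \<omega>) (of_nat N)) (p - 1)) \<longlongrightarrow> ennreal p * ennpowr (min (Z t \<omega>) (of_nat N)) (p - 1)) (at_left t)"
            by (intro ennreal_tendsto_cmult 1) simp
          have "\<phi> t \<omega> \<le> \<phi> T \<omega>" using t elim by (intro \<phi>_mono) auto
          then have "\<phi> t \<omega> < \<top>" using elim by (auto simp: less_top intro: le_less_trans)
          then show "((\<lambda>s. \<psi> s \<omega>) \<longlongrightarrow> \<psi> t \<omega>) (at_left t)"
            unfolding \<psi>_def using elim(1) t less_imp_neq[OF fin1]
            by (intro tendsto_mult_ennreal[OF 2]) (auto simp: ennreal_mult_eq_top_iff)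
        qed
      qed
      have "?L \<le> (\<integral>\<^sup>+ \<omega>. (\<integral>\<^sup>+ s\<in>{0..T}. \<psi> s \<omega> * b s \<omega> \<partial>lborel) \<partial>M)"
      proof (rule nn_integral_mono_AE)
        show "AE \<omega> in M. ennpowr (min (Z T \<omega>) (of_nat N)) p \<le> (\<integral>\<^sup>+ s\<in>{0..T}. \<psi> s \<omega> * b s \<omega> \<partial>lborel)"
          using AE_space Z_AE by eventually_elim (rule path)
      qed
      also have "\<dots> \<le> ennreal k * (\<integral>\<^sup>+ \<omega>. \<psi> T \<omega> \<partial>M)"
      proof (rule key)
        show "\<psi> t \<in> borel_measurable (F t)" if "t \<in> {0..T}" for t
          using \<psi> that by (rule progressive_nn_section)
        show "\<psi> s \<omega> \<le> \<psi> t \<omega>" if "0 \<le> s" "s \<le> t" "t \<le> T" "\<omega> \<in> space M" for s t \<omega>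
          unfolding \<psi>_def using p that
          by (intro mult_mono ennpowr_mono min.mono Z_mono \<phi>_mono) auto
      qed (use left in auto)
      also have "\<dots> = (\<integral>\<^sup>+ \<omega>. ennreal k * \<psi> T \<omega> \<partial>M)"
        by (rule nn_integral_cmult[symmetric]) (rule from_F[OF progressive_nn_section[OF \<psi> T'] T'])
      \<comment> \<open>Young's inequality with \<open>x\<close> the truncated \<open>Z T\<close>
        and \<open>y = p * k * \<phi> T\<close>; with the constant put into \<open>y\<close>, the
        second term integrates to \<open>R / p\<close>.\<close>
      also have "\<dots> \<le> (\<integral>\<^sup>+ \<omega>. ennreal (1 - 1/p) * ennpowr (min (Z T \<omega>) (of_nat N)) p
          + ennreal (1/p) * ennpowr (ennreal (p * k) * \<phi> T \<omega>) p \<partial>M)"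
      proof (rule nn_integral_mono_AE)
        show "AE \<omega> in M. ennreal k * \<psi> T \<omega> \<le> ennreal (1 - 1/p) * ennpowr (min (Z T \<omega>) (of_nat N)) p
            + ennreal (1/p) * ennpowr (ennreal (p * k) * \<phi> T \<omega>) p"
          using \<phi>_AE
        proof eventually_elim
          case (elim \<omega>)
          then obtain y where y: "0 \<le> y" "\<phi> T \<omega> = ennreal y" by (cases "\<phi> T \<omega>") auto
          obtain z where z: "0 \<le> z" "min (Z T \<omega>) (of_nat N) = ennreal z"
            using min_top[of "Z T \<omega>"] by (cases "min (Z T \<omega>) (of_nat N)") auto
          have "ennreal k * \<psi> T \<omega> = ennreal (z powr (p - 1) * (p * k * y))"
            using y z p k by (simp add: \<psi>_def ennpowr_ennreal mult_ac flip: ennreal_mult)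
          also have "\<dots> \<le> ennreal ((1 - 1/p) * z powr p + (p * k * y) powr p / p)"
            using p k y z by (intro ennreal_leI Youngs_inequality_powr_minus_1) auto
          also have "\<dots> = ennreal (1 - 1/p) * ennpowr (min (Z T \<omega>) (of_nat N)) p
            + ennreal (1/p) * ennpowr (ennreal (p * k) * \<phi> T \<omega>) p"
            using y z p k by (simp add: ennpowr_ennreal flip: ennreal_mult ennreal_plus)
          finally show ?case .
        qed
      qed
      also have "\<dots> = ennreal (1 - 1/p) * ?L + ennreal (1/p) * R"
        unfolding R_eq by (subst nn_integral_add) (auto simp: nn_integral_cmult)
      finally have *: "?L \<le> ennreal (1 - 1/p) * ?L + ennreal (1/p) * R" .
      \<comment> \<open>The truncation makes \<open>?L\<close> finite, so
        \<open>(1 - 1/p) * ?L\<close> can be subtracted in the reals.\<close>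
      have "?L \<le> (\<integral>\<^sup>+ \<omega>. ennpowr (of_nat N) p \<partial>M)"
        using p by (intro nn_integral_mono ennpowr_mono) auto
      also have "\<dots> < \<top>" by (simp add: emeasure_space_1 ennreal_of_nat_eq_real_of_nat)
      finally obtain l where l: "0 \<le> l" "?L = ennreal l" by (cases ?L) auto
      from R_fin obtain r where r: "0 \<le> r" "R = ennreal r" by (cases R) auto
      have "l \<le> (1 - 1/p) * l + (1/p) * r"
        using * l r p by (simp flip: ennreal_mult ennreal_plus)
      then have "l \<le> r" using p by (simp add: field_simps)
      then show ?thesis using l r by (simp add: ennreal_leI)
    qed
    have "(\<integral>\<^sup>+ \<omega>. ennpowr (Z T \<omega>) p \<partial>M) \<le> (\<integral>\<^sup>+ \<omega>. (SUP N. ennpowr (min (Z T \<omega>) (of_nat N)) p) \<partial>M)"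
    proof (rule nn_integral_mono_AE)
      show "AE \<omega> in M. ennpowr (Z T \<omega>) p \<le> (SUP N. ennpowr (min (Z T \<omega>) (of_nat N)) p)"
        using Z_AE
      proof eventually_elim
        case (elim \<omega>)
        then obtain N :: nat where "Z T \<omega> \<le> of_nat N"
          by (metis ennreal_Ex_less_of_nat infinity_ennreal_def less_imp_le less_top)
        then have "ennpowr (Z T \<omega>) p = ennpowr (min (Z T \<omega>) (of_nat N)) p"
          by (simp add: min_absorb1)
        also have "\<dots> \<le> (SUP N. ennpowr (min (Z T \<omega>) (of_nat N)) p)"
          by (rule SUP_upper) simp
        finally show ?case .
      qed
    qed
    also have "\<dots> = (SUP N. \<integral>\<^sup>+ \<omega>. ennpowr (min (Z T \<omega>) (of_nat N)) p \<partial>M)"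
      using p by (intro nn_integral_monotone_convergence_SUP)
        (auto simp: incseq_def le_fun_def intro!: ennpowr_mono min.mono)
    also have "\<dots> \<le> R" using trunc by (rule SUP_least)
    finally show ?thesis unfolding R_def .
  qed
qed

text \<open>An \<open>F t\<close>-measurable weight passes through the conditional expectation,
  whose essential supremum is at most the squared BMO norm. This is the tested form of the BMO
  condition that the inequality for increasing integrands takes as its hypothesis.\<close>

lemma BMO_norm_bound:
  assumes basis: "stochastic_basis M F T" and B: "progressively_measurable F T B"
    and t: "t \<in> {0..T}" and f: "f \<in> borel_measurable (F t)"
  shows "(\<integral>\<^sup>+ \<omega>. f \<omega> * (\<integral>\<^sup>+ s\<in>{t..T}. ennreal (\<bar>B s \<omega>\<bar>\<^sup>2) \<partial>lborel) \<partial>M)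
    \<le> ennpowr (BMO_norm M F T B) 2 * (\<integral>\<^sup>+ \<omega>. f \<omega> \<partial>M)"
proof -
  interpret stochastic_basis M F T by fact
  have T': "T \<in> {0..T}" using T_pos by simp
  have "finite_measure_subalgebra M (F t)"
    using subalgebra_F[OF t] by unfold_locales
  then have "sigma_finite_subalgebra M (F t)"
    by (rule finite_measure_subalgebra_is_sigma_finite)
  note nn_cond_exp_intg = sigma_finite_subalgebra.nn_cond_exp_intg[OF this]
  let ?R = "\<lambda>\<omega>. \<integral>\<^sup>+ s\<in>{t..T}. ennreal (\<bar>B s \<omega>\<bar>\<^sup>2) \<partial>lborel"
  let ?E = "nn_cond_exp M (F t) ?R"
  have "progressive_nn F T (\<lambda>s \<omega>. ennreal (\<bar>B s \<omega>\<bar>\<^sup>2))"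
    using B by (rule progressive_nn_compose_real) measurable
  from progressive_nn_joint[OF this T']
  have [measurable]: "(\<lambda>(\<omega>, s). ennreal (\<bar>B s \<omega>\<bar>\<^sup>2) * indicator {0..T} s) \<in> borel_measurable (F T \<Otimes>\<^sub>M lborel)" .
  have "(\<lambda>x. (\<lambda>(\<omega>, s). ennreal (\<bar>B s \<omega>\<bar>\<^sup>2) * indicator {0..T} s) x * indicator {t..T} (snd x))
      \<in> borel_measurable (F T \<Otimes>\<^sub>M lborel)"
    by measurable
  then have "(\<lambda>(\<omega>, s). ennreal (\<bar>B s \<omega>\<bar>\<^sup>2) * indicator {t..T} s) \<in> borel_measurable (F T \<Otimes>\<^sub>M lborel)"
    by (rule measurable_cong[THEN iffD1, rotated]) (use t in \<open>auto simp: indicator_def\<close>)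
  then have "?R \<in> borel_measurable (F T)"
    by (rule lborel.borel_measurable_nn_integral)
  then have R: "?R \<in> borel_measurable M"
    using subalgebra_F[OF T'] by (rule measurable_from_subalg[rotated])
  have f': "f \<in> borel_measurable M"
    using subalgebra_F[OF t] f by (rule measurable_from_subalg)
  have "esssup M ?E = ennpowr (ennpowr (esssup M ?E) (1/2)) 2"
    by (simp add: ennpowr_ennpowr)
  also have "\<dots> \<le> ennpowr (BMO_norm M F T B) 2"
    unfolding BMO_norm_def using t by (intro ennpowr_mono SUP_upper) auto
  finally have sup: "esssup M ?E \<le> ennpowr (BMO_norm M F T B) 2" .
  have "(\<integral>\<^sup>+ \<omega>. f \<omega> * ?R \<omega> \<partial>M) = (\<integral>\<^sup>+ \<omega>. f \<omega> * ?E \<omega> \<partial>M)"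
    by (rule nn_cond_exp_intg[OF f R, symmetric])
  also have "\<dots> \<le> (\<integral>\<^sup>+ \<omega>. ennpowr (BMO_norm M F T B) 2 * f \<omega> \<partial>M)"
  proof (rule nn_integral_mono_AE)
    show "AE \<omega> in M. f \<omega> * ?E \<omega> \<le> ennpowr (BMO_norm M F T B) 2 * f \<omega>"
      using esssup_AE[where M = M and f = ?E]
    proof eventually_elim
      case (elim \<omega>)
      then show ?case
        using order.trans[OF elim sup] by (subst mult.commute) (intro mult_right_mono, auto)
    qed
  qed
  also have "\<dots> = ennpowr (BMO_norm M F T B) 2 * (\<integral>\<^sup>+ \<omega>. f \<omega> \<partial>M)"
    by (rule nn_integral_cmult[OF f'])
  finally show ?thesis .
qed

text \<open>With \<open>\<nu>\<close> the BMO norm and \<open>E\<close> the \<open>p\<close>-th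
  moment of the product integral, the pathwise estimate and Cauchy--Schwarz over the sample space
  bound \<open>E ^ 2\<close> by \<open>2 ^ p * J\<close> times the \<open>p\<close>-th moment of
  \<open>Z T\<close>. Garsia's inequality with \<open>k = \<nu> ^ 2\<close> turns this into
  \<open>(2 * p * \<nu> ^ 2) ^ p * J ^ 2\<close>, and the \<open>2 * p\<close>-th root is the
  claim.\<close>

lemma product_bound_sqrt:
  assumes adm: "admissible M F T A B" and p: "1 \<le> p"
  shows "product_bound M F T p (ennreal (sqrt (2 * p))) A B"
proof -
  from adm have basis: "stochastic_basis M F T" and A: "progressively_measurable F T A"
    and B: "progressively_measurable F T B"
    by (auto simp: admissible_def)
  interpret stochastic_basis M F T by fact
  have T': "T \<in> {0..T}" using T_pos by simp
  let ?I = "indicator {0..T} :: real \<Rightarrow> ennreal"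
  define a where "a \<omega> s = ennreal \<bar>A s \<omega>\<bar>" for \<omega> s
  define b where "b \<omega> s = ennreal \<bar>B s \<omega>\<bar>" for \<omega> s
  define X where "X \<omega> = (\<integral>\<^sup>+ s\<in>{0..T}. a \<omega> s * b \<omega> s \<partial>lborel)" for \<omega>
  define \<alpha> where "\<alpha> s \<omega> = (\<integral>\<^sup>+ u\<in>{0..s}. ennreal (\<bar>A u \<omega>\<bar>\<^sup>2) \<partial>lborel)" for s \<omega>
  define \<phi> where "\<phi> s \<omega> = ennpowr (\<alpha> s \<omega>) (1/2)" for s \<omega>
  define b2 where "b2 s \<omega> = ennreal (\<bar>B s \<omega>\<bar>\<^sup>2)" for s \<omega>
  define Z where "Z t \<omega> = (\<integral>\<^sup>+ s\<in>{0..t}. \<phi> s \<omega> * b2 s \<omega> \<partial>lborel)" for t \<omega>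
  let ?N = "BMO_norm M F T B"
  define J where "J = (\<integral>\<^sup>+ \<omega>. ennpowr (\<phi> T \<omega>) p \<partial>M)"
  have X_eq: "(\<integral>\<^sup>+ s\<in>{0..T}. ennreal \<bar>A s \<omega> * B s \<omega>\<bar> \<partial>lborel) = X \<omega>" for \<omega>
    by (simp add: X_def a_def b_def abs_mult ennreal_mult)
  have H_eq: "H_norm M T p A = ennpowr J (1/p)"
    by (simp add: H_norm_def Lp_norm_def J_def \<phi>_def \<alpha>_def)
  have a2: "(a \<omega> s)\<^sup>2 = ennreal (\<bar>A s \<omega>\<bar>\<^sup>2)" and b2: "(b \<omega> s)\<^sup>2 = b2 s \<omega>" for \<omega> s
    by (simp_all add: a_def b_def b2_def ennreal_power)
  have goal: "product_bound M F T p (ennreal (sqrt (2 * p))) A B \<longleftrightarrow>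
      ennpowr (\<integral>\<^sup>+ \<omega>. ennpowr (X \<omega>) p \<partial>M) (1/p) \<le> ennreal (sqrt (2 * p)) * ennpowr J (1/p) * ?N"
    by (simp add: product_bound_def Lp_norm_def X_eq H_eq)
  have pa: "progressive_nn F T (\<lambda>s \<omega>. a \<omega> s)" and pb: "progressive_nn F T (\<lambda>s \<omega>. b \<omega> s)"
    unfolding a_def b_def
    by (rule progressive_nn_compose_real[OF A], measurable) (rule progressive_nn_compose_real[OF B], measurable)
  have pb2: "progressive_nn F T b2" and p\<alpha>: "progressive_nn F T \<alpha>"
    unfolding b2_def \<alpha>_def
    by (rule progressive_nn_compose_real[OF B], measurable)
      (intro progressive_nn_integral progressive_nn_compose_real[OF A], measurable)
  have p\<phi>: "progressive_nn F T \<phi>"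
    unfolding \<phi>_def by (rule progressive_nn_compose[OF p\<alpha>]) measurable
  have pZ: "progressive_nn F T Z"
    unfolding Z_def by (intro progressive_nn_integral progressive_nn_mult p\<phi> pb2)
  have from_T: "f \<in> borel_measurable M" if "f \<in> borel_measurable (F T)" for f :: "'a \<Rightarrow> ennreal"
    using subalgebra_F[OF T'] that by (rule measurable_from_subalg)
  have [measurable]: "\<alpha> T \<in> borel_measurable M" "\<phi> T \<in> borel_measurable M" "Z T \<in> borel_measurable M"
    by (rule from_T[OF progressive_nn_section[OF p\<alpha> T']], rule from_T[OF progressive_nn_section[OF p\<phi> T']],
        rule from_T[OF progressive_nn_section[OF pZ T']])
  have b2_T [measurable]: "(\<lambda>\<omega>. \<integral>\<^sup>+ s\<in>{0..T}. b2 s \<omega> \<partial>lborel) \<in> borel_measurable M"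
    by (rule from_T[OF progressive_nn_section[OF progressive_nn_integral[OF pb2] T']])
  have sp: "space (F T) = space M"
    using subalgebra_F[OF T'] by (simp add: subalgebra_def)
  have path_a: "(\<lambda>s. a \<omega> s * ?I s) \<in> borel_measurable borel"
    and path_b: "(\<lambda>s. b \<omega> s * ?I s) \<in> borel_measurable borel" if "\<omega> \<in> space M" for \<omega>
    using progressive_nn_path[OF pa, of \<omega>] progressive_nn_path[OF pb, of \<omega>] T_pos that sp by simp_all
  have CS: "(X \<omega>)\<^sup>2 \<le> \<alpha> T \<omega> * (\<integral>\<^sup>+ s\<in>{0..T}. b2 s \<omega> \<partial>lborel)" if "\<omega> \<in> space M" for \<omega>
  proof -
    have "X \<omega> = (\<integral>\<^sup>+ s. (a \<omega> s * ?I s) * (b \<omega> s * ?I s) \<partial>lborel)"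
      unfolding X_def by (intro nn_integral_cong) (auto simp: indicator_def)
    then have "(X \<omega>)\<^sup>2 \<le> (\<integral>\<^sup>+ s. (a \<omega> s * ?I s)\<^sup>2 \<partial>lborel) * (\<integral>\<^sup>+ s. (b \<omega> s * ?I s)\<^sup>2 \<partial>lborel)"
      using path_a[OF that] path_b[OF that] by (simp add: Cauchy_Schwarz_nn_integral)
    also have "(\<integral>\<^sup>+ s. (a \<omega> s * ?I s)\<^sup>2 \<partial>lborel) = \<alpha> T \<omega>"
      unfolding \<alpha>_def by (intro nn_integral_cong) (auto simp: indicator_def a2)
    also have "(\<integral>\<^sup>+ s. (b \<omega> s * ?I s)\<^sup>2 \<partial>lborel) = (\<integral>\<^sup>+ s\<in>{0..T}. b2 s \<omega> \<partial>lborel)"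
      by (intro nn_integral_cong) (auto simp: indicator_def b2)
    finally show ?thesis .
  qed
  \<comment> \<open>By the convention \<open>0 * \<infinity> = 0\<close> the right side may vanish
    although its other factor is infinite. The unweighted Cauchy--Schwarz inequality
    \<open>CS\<close> shows that the left side vanishes as well.\<close>
  have null: ?thesis if "AE \<omega> in M. \<alpha> T \<omega> = 0 \<or> (\<integral>\<^sup>+ s\<in>{0..T}. b2 s \<omega> \<partial>lborel) = 0"
  proof -
    have "AE \<omega> in M. ennpowr (X \<omega>) p = 0"
      using that AE_space
    proof eventually_elim
      case (elim \<omega>)
      then have "(X \<omega>)\<^sup>2 \<le> 0" using CS[of \<omega>] by auto
      then show ?case by simp
    qed
    then have "(\<integral>\<^sup>+ \<omega>. ennpowr (X \<omega>) p \<partial>M) = (\<integral>\<^sup>+ \<omega>. 0 \<partial>M)"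
      by (rule nn_integral_cong_AE)
    then show ?thesis unfolding goal by simp
  qed
  have bound: "(\<integral>\<^sup>+ \<omega>. f \<omega> * (\<integral>\<^sup>+ s\<in>{t..T}. b2 s \<omega> \<partial>lborel) \<partial>M) \<le> ennpowr ?N 2 * (\<integral>\<^sup>+ \<omega>. f \<omega> \<partial>M)"
    if "t \<in> {0..T}" "f \<in> borel_measurable (F t)" for t f
    unfolding b2_def by (rule BMO_norm_bound[OF basis B that])
  \<comment> \<open>Vanishing factors come first; only then does an infinite factor make the right
    side infinite. What remains is the finite case.\<close>
  consider "J = 0" | "?N = 0" | "J \<noteq> 0" "?N \<noteq> 0" "J = \<top> \<or> ?N = \<top>" | "J \<noteq> \<top>" "?N \<noteq> \<top>"
    by blast
  then show ?thesis
  proof cases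
    case 1
    then have "AE \<omega> in M. ennpowr (\<phi> T \<omega>) p = 0"
      unfolding J_def by (subst (asm) nn_integral_0_iff_AE) auto
    then show ?thesis by (intro null) (auto simp: \<phi>_def elim: eventually_mono)
  next
    case 2
    have "(\<integral>\<^sup>+ \<omega>. (\<integral>\<^sup>+ s\<in>{0..T}. b2 s \<omega> \<partial>lborel) \<partial>M) = 0"
      using bound[of 0 "\<lambda>_. 1"] T_pos 2 by simp
    then have "AE \<omega> in M. (\<integral>\<^sup>+ s\<in>{0..T}. b2 s \<omega> \<partial>lborel) = 0"
      by (subst (asm) nn_integral_0_iff_AE) auto
    then show ?thesis by (intro null) (auto elim: eventually_mono)
  next
    case 3
    then have "ennreal (sqrt (2 * p)) * ennpowr J (1/p) * ?N = \<top>"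
      using p by (auto simp: ennreal_mult_eq_top_iff)
    then show ?thesis unfolding goal by simp
  next
    case 4
    then obtain \<nu> where \<nu>: "0 \<le> \<nu>" "?N = ennreal \<nu>" by (cases ?N) auto
    have K: "ennpowr ?N 2 = ennreal (\<nu>\<^sup>2)"
      using \<nu> by (simp add: ennpowr_2 ennreal_power)
    have "AE \<omega> in M. ennpowr (\<phi> T \<omega>) p \<noteq> \<infinity>"
      using 4 unfolding J_def by (intro nn_integral_PInf_AE) auto
    then have \<alpha>_AE: "AE \<omega> in M. \<alpha> T \<omega> < \<infinity>"
      by eventually_elim (auto simp: \<phi>_def less_top)
    have EZ: "(\<integral>\<^sup>+ \<omega>. ennpowr (Z T \<omega>) p \<partial>M) \<le> ennpowr (p * \<nu>\<^sup>2) p * J"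
      unfolding Z_def J_def
    proof (rule progressive_Garsia_inequality[OF T_pos p _ subalgebra_F sets_F_mono pb2])
      show "(\<integral>\<^sup>+ \<omega>. f \<omega> * (\<integral>\<^sup>+ s\<in>{t..T}. b2 s \<omega> \<partial>lborel) \<partial>M) \<le> ennreal (\<nu>\<^sup>2) * (\<integral>\<^sup>+ \<omega>. f \<omega> \<partial>M)"
        if "t \<in> {0..T}" "f \<in> borel_measurable (F t)" for t f
        using bound[OF that] K by simp
      show "\<phi> s \<omega> \<le> \<phi> t \<omega>" if "0 \<le> s" "s \<le> t" "t \<le> T" "\<omega> \<in> space M" for s t \<omega>
        unfolding \<phi>_def \<alpha>_def using that
        by (intro ennpowr_mono nn_integral_mono) (auto simp: indicator_def)
      show "AE \<omega> in M. \<forall>t\<in>{0<..T}. ((\<lambda>s. \<phi> s \<omega>) \<longlongrightarrow> \<phi> t \<omega>) (at_left t)"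
        using \<alpha>_AE AE_space
      proof eventually_elim
        case (elim \<omega>)
        show ?case
        proof
          fix t assume t: "t \<in> {0<..T}"
          have "(\<lambda>s. (a \<omega> s * ?I s)\<^sup>2) \<in> borel_measurable borel"
            using path_a[OF elim(2)] by measurable
          then have "(\<lambda>s. ennreal (\<bar>A s \<omega>\<bar>\<^sup>2) * ?I s) \<in> borel_measurable borel"
            by (rule measurable_cong[THEN iffD1, rotated]) (auto simp: indicator_def a2)
          then have "((\<lambda>s. \<alpha> s \<omega>) \<longlongrightarrow> \<alpha> t \<omega>) (at_left t)"
            unfolding \<alpha>_def using elim(1) t
            by (intro tendsto_cumulative_integral_at_left[of _ T]) (auto simp: \<alpha>_def)
          moreover have "\<alpha> t \<omega> \<le> \<alpha> T \<omega>"
            unfolding \<alpha>_def using t by (intro nn_integral_mono) (auto simp: indicator_def)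
          ultimately show "((\<lambda>s. \<phi> s \<omega>) \<longlongrightarrow> \<phi> t \<omega>) (at_left t)"
            unfolding \<phi>_def using elim(1) by (intro tendsto_ennpowr) (auto intro: le_less_trans)
        qed
      qed
      show "(\<integral>\<^sup>+ \<omega>. ennpowr (\<phi> T \<omega>) p \<partial>M) < \<infinity>"
        using 4 by (simp add: J_def less_top)
    qed (use p\<phi> in \<open>auto simp: b2_def\<close>)
    define E where "E = (\<integral>\<^sup>+ \<omega>. ennpowr (X \<omega>) p \<partial>M)"
    define S where "S = (\<integral>\<^sup>+ \<omega>. ennpowr (\<phi> T \<omega>) (p/2) * ennpowr (Z T \<omega>) (p/2) \<partial>M)"
    have "E \<le> (\<integral>\<^sup>+ \<omega>. ennpowr 2 (p/2) * (ennpowr (\<phi> T \<omega>) (p/2) * ennpowr (Z T \<omega>) (p/2)) \<partial>M)"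
      unfolding E_def
    proof (rule nn_integral_mono_AE)
      show "AE \<omega> in M. ennpowr (X \<omega>) p \<le> ennpowr 2 (p/2) * (ennpowr (\<phi> T \<omega>) (p/2) * ennpowr (Z T \<omega>) (p/2))"
        using \<alpha>_AE AE_space
      proof eventually_elim
        case (elim \<omega>)
        have "(X \<omega>)\<^sup>2 \<le> 2 * \<phi> T \<omega> * Z T \<omega>"
          using weighted_Cauchy_Schwarz_cumulative[of T "a \<omega>" "b \<omega>"] path_a path_b elim T_pos
          by (simp add: X_def \<phi>_def Z_def \<alpha>_def a2 b2)
        then have "ennpowr (ennpowr (X \<omega>) 2) (p/2) \<le> ennpowr (2 * \<phi> T \<omega> * Z T \<omega>) (p/2)"
          using p by (intro ennpowr_mono) (auto simp: ennpowr_2)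
        then show ?case by (simp add: ennpowr_mult ennpowr_ennpowr mult.assoc)
      qed
    qed
    also have "\<dots> = ennpowr 2 (p/2) * S"
      unfolding S_def by (rule nn_integral_cmult) measurable
    finally have "E\<^sup>2 \<le> (ennpowr 2 (p/2) * S)\<^sup>2"
      by (rule power_mono) simp
    also have "\<dots> = ennpowr 2 p * S\<^sup>2"
      by (simp add: ennpowr_mult ennpowr_ennpowr flip: ennpowr_2)
    finally have E_S: "E\<^sup>2 \<le> ennpowr 2 p * S\<^sup>2" .
    have "S\<^sup>2 \<le> (\<integral>\<^sup>+ \<omega>. (ennpowr (\<phi> T \<omega>) (p/2))\<^sup>2 \<partial>M) * (\<integral>\<^sup>+ \<omega>. (ennpowr (Z T \<omega>) (p/2))\<^sup>2 \<partial>M)"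
      unfolding S_def by (rule Cauchy_Schwarz_nn_integral) measurable
    also have "\<dots> = J * (\<integral>\<^sup>+ \<omega>. ennpowr (Z T \<omega>) p \<partial>M)"
      by (simp add: J_def ennpowr_ennpowr flip: ennpowr_2)
    also have "\<dots> \<le> J * (ennpowr (p * \<nu>\<^sup>2) p * J)"
      using EZ by (rule mult_left_mono) simp
    also have "\<dots> = ennpowr (p * \<nu>\<^sup>2) p * ennpowr J 2"
      by (simp add: ennpowr_2 power2_eq_square mult_ac)
    finally have "ennpowr E 2 \<le> ennpowr 2 p * (ennpowr (p * \<nu>\<^sup>2) p * ennpowr J 2)"
      using order.trans[OF E_S mult_left_mono] by (simp add: ennpowr_2)
    then have "ennpowr (ennpowr E 2) (1/(2*p))
        \<le> ennpowr (ennpowr 2 p * (ennpowr (p * \<nu>\<^sup>2) p * ennpowr J 2)) (1/(2*p))"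
      using p by (intro ennpowr_mono) auto
    then have "ennpowr E (1/p) \<le> ennpowr 2 (1/2) * (ennpowr (p * \<nu>\<^sup>2) (1/2) * ennpowr J (1/p))"
      using p by (simp add: ennpowr_mult ennpowr_ennpowr)
    also have "ennpowr 2 (1/2) * (ennpowr (p * \<nu>\<^sup>2) (1/2) * ennpowr J (1/p))
        = ennreal (sqrt (2 * p)) * ennpowr J (1/p) * ?N"
    proof -
      have "ennpowr 2 (1/2) * ennpowr (p * \<nu>\<^sup>2) (1/2) = ennreal (2 powr (1/2)) * ennreal ((p * \<nu>\<^sup>2) powr (1/2))"
        using p ennpowr_ennreal[of 2 "1/2"] by (simp add: ennpowr_ennreal)
      also have "\<dots> = ennreal (sqrt (2 * p) * \<nu>)"
        using p \<nu> by (simp add: powr_half_sqrt real_sqrt_mult flip: ennreal_mult)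
      finally have "ennpowr 2 (1/2) * ennpowr (p * \<nu>\<^sup>2) (1/2) = ennreal (sqrt (2 * p)) * ?N"
        using \<nu> p by (simp add: ennreal_mult)
      then show ?thesis by (metis mult.assoc mult.commute)
    qed
    finally show ?thesis unfolding goal E_def .
  qed
qed

section \<open>The lower bound\<close>

text \<open>At time \<open>t\<close> the points with \<open>\<tau> \<le> t\<close> are fully known,
  while the survivors form a single atom. The generating family is already a sigma-algebra.\<close>

definition death_filtration :: "'a set \<Rightarrow> ('a \<Rightarrow> real) \<Rightarrow> real \<Rightarrow> 'a measure" where
  "death_filtration \<Omega> \<tau> t =
     sigma \<Omega> {S \<in> Pow \<Omega>. \<forall>x\<in>\<Omega>. \<forall>y\<in>\<Omega>. t < \<tau> x \<longrightarrow> t < \<tau> y \<longrightarrow> (x \<in> S \<longleftrightarrow> y \<in> S)}"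

lemma space_death_filtration [simp]: "space (death_filtration \<Omega> \<tau> t) = \<Omega>"
  by (auto simp: death_filtration_def intro!: space_measure_of)

lemma sets_death_filtration:
  "sets (death_filtration \<Omega> \<tau> t) =
     {S \<in> Pow \<Omega>. \<forall>x\<in>\<Omega>. \<forall>y\<in>\<Omega>. t < \<tau> x \<longrightarrow> t < \<tau> y \<longrightarrow> (x \<in> S \<longleftrightarrow> y \<in> S)}"
proof -
  have "sigma_algebra \<Omega> {S \<in> Pow \<Omega>. \<forall>x\<in>\<Omega>. \<forall>y\<in>\<Omega>. t < \<tau> x \<longrightarrow> t < \<tau> y \<longrightarrow> (x \<in> S \<longleftrightarrow> y \<in> S)}"
    unfolding sigma_algebra_iff2 by (intro conjI allI ballI impI) (blast | force)+
  then show ?thesis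
    unfolding death_filtration_def by (rule sigma_algebra.sets_measure_of_eq)
qed

lemma sets_death_filtration_mono:
  assumes "s \<le> t"
  shows "sets (death_filtration \<Omega> \<tau> s) \<subseteq> sets (death_filtration \<Omega> \<tau> t)"
proof
  fix S assume "S \<in> sets (death_filtration \<Omega> \<tau> s)"
  moreover have "s < \<tau> x" if "t < \<tau> x" for x using assms that by simp
  ultimately show "S \<in> sets (death_filtration \<Omega> \<tau> t)"
    unfolding sets_death_filtration by blast
qed

text \<open>Strictly positive weights make the empty set the only null set, so almost sure
  statements hold everywhere on \<open>\<Omega>\<close>.\<close>

locale death_time =
  fixes \<Omega> :: "'a set" and w \<tau> :: "'a \<Rightarrow> real" and T :: real
  assumes finite_\<Omega>: "finite \<Omega>" and w_pos: "\<And>x. x \<in> \<Omega> \<Longrightarrow> 0 < w x" and w_sum: "sum w \<Omega> = 1"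
    and \<tau>: "\<And>x. x \<in> \<Omega> \<Longrightarrow> 0 < \<tau> x \<and> \<tau> x \<le> T"
begin

abbreviation "P \<equiv> point_measure \<Omega> (\<lambda>x. ennreal (w x))"
abbreviation "F \<equiv> death_filtration \<Omega> \<tau>"

definition alive :: "real \<Rightarrow> 'a \<Rightarrow> real" where
  "alive s x = (if s < \<tau> x then 1 else 0)"

lemma T_pos: "0 < T"
proof -
  from w_sum obtain x where "x \<in> \<Omega>" by (metis all_not_in_conv sum.empty zero_neq_one)
  then show ?thesis using \<tau>[of x] by linarith
qed

lemma nn_integral_P: "(\<integral>\<^sup>+ x. f x \<partial>P) = (\<Sum>x\<in>\<Omega>. ennreal (w x) * f x)"
  using finite_\<Omega> by (rule nn_integral_point_measure_finite)

lemma AE_P: "(AE x in P. Q x) \<longleftrightarrow> (\<forall>x\<in>\<Omega>. Q x)"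
  using w_pos by (auto simp: AE_point_measure)

text \<open>Right-continuity rests on the strict inequality in the definition of survivors: two
  points alive at \<open>t\<close> are both still alive at some later \<open>s\<close>, so a set
  belonging to all later sigma-algebras cannot separate them. At time \<open>T\<close> there are no
  survivors, so every subset of \<open>\<Omega>\<close> is known.\<close>

lemma stochastic_basis_P: "stochastic_basis P F T"
proof -
  have "emeasure P (space P) = ennreal (sum w \<Omega>)"
    using finite_\<Omega> w_pos by (simp add: space_point_measure emeasure_point_measure_finite sum_ennreal less_imp_le)
  then have "prob_space P" by (intro prob_spaceI) (simp add: w_sum)
  moreover have "complete_measure P"
    by unfold_locales (auto simp: sets_point_measure null_sets_point_measure_iff)
  moreover have "stochastic_basis_axioms P F T"
  proof
    show "0 < T" by (rule T_pos)
    show "subalgebra P (F t)" for t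
      by (auto simp: subalgebra_def space_point_measure sets_point_measure sets_death_filtration)
    show "sets (F s) \<subseteq> sets (F t)" if "s \<le> t" for s t
      using that by (rule sets_death_filtration_mono)
    show "sets (F t) = (\<Inter>s\<in>{t<..T}. sets (F s))" if t: "t \<in> {0..<T}" for t
    proof
      show "sets (F t) \<subseteq> (\<Inter>s\<in>{t<..T}. sets (F s))"
        by (intro INT_greatest sets_death_filtration_mono) auto
      show "(\<Inter>s\<in>{t<..T}. sets (F s)) \<subseteq> sets (F t)"
      proof
        fix S assume S: "S \<in> (\<Inter>s\<in>{t<..T}. sets (F s))"
        have "S \<in> sets (F T)" using S t by auto
        then have "S \<subseteq> \<Omega>" by (simp add: sets_death_filtration)
        moreover have "x \<in> S \<longleftrightarrow> y \<in> S" if xy: "x \<in> \<Omega>" "y \<in> \<Omega>" "t < \<tau> x" "t < \<tau> y" for x y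
        proof -
          obtain s where s: "t < s" "s < min (\<tau> x) (\<tau> y)"
            using xy dense[of t "min (\<tau> x) (\<tau> y)"] by auto
          then have "s \<in> {t<..T}" using \<tau>[OF xy(1)] by auto
          then have "S \<in> sets (F s)" using S by blast
          moreover from s have "s < \<tau> x" "s < \<tau> y" by simp_all
          ultimately show ?thesis using xy(1,2) unfolding sets_death_filtration by blast
        qed
        ultimately show "S \<in> sets (F t)" unfolding sets_death_filtration by blast
      qed
    qed
    show "null_sets P \<subseteq> sets (F 0)"
    proof
      fix N assume "N \<in> null_sets P"
      then have N: "N \<subseteq> \<Omega>" "\<And>x. x \<in> N \<Longrightarrow> w x \<le> 0"
        by (auto simp: null_sets_point_measure_iff ennreal_eq_0_iff)
      have "x \<notin> N" for x using N w_pos[of x] by fastforce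
      then have "N = {}" by blast
      then show "N \<in> sets (F 0)" by simp
    qed
    show "sets (F T) = sets P"
    proof -
      have "\<not> T < \<tau> x" if "x \<in> \<Omega>" for x using \<tau>[OF that] by simp
      then show ?thesis by (auto simp: sets_death_filtration sets_point_measure)
    qed
  qed
  ultimately show ?thesis by (intro stochastic_basis.intro)
qed

lemma progressively_measurable_alive: "progressively_measurable F T alive"
  unfolding progressively_measurable_def
proof
  fix t assume t: "t \<in> {0..T}"
  \<comment> \<open>A version of \<open>\<tau>\<close> known at time \<open>t\<close>: it is
    constant on the survivors, with a value above \<open>t\<close>, so \<open>s < \<sigma> x\<close>
    and \<open>s < \<tau> x\<close> agree for all \<open>s\<close> up to \<open>t\<close>.\<close>
  define \<sigma> where "\<sigma> x = (if t < \<tau> x then t + 1 else \<tau> x)" for x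
  have [measurable]: "\<sigma> \<in> borel_measurable (F t)"
  proof (rule measurableI)
    fix A :: "real set"
    show "\<sigma> -` A \<inter> space (F t) \<in> sets (F t)"
      by (auto simp: sets_death_filtration \<sigma>_def)
  qed simp
  let ?N = "restrict_space borel {0..t} \<Otimes>\<^sub>M F t"
  have [measurable]: "fst \<in> borel_measurable ?N"
    by (intro measurable_compose[OF measurable_fst] measurable_restrict_space1) simp
  have "(\<lambda>z. if fst z < \<sigma> (snd z) then 1 else 0 :: real) \<in> borel_measurable ?N"
    by measurable
  then show "(\<lambda>(s, x). alive s x) \<in> borel_measurable ?N"
    by (rule measurable_cong[THEN iffD1, rotated])
      (auto simp: space_pair_measure space_restrict_space alive_def \<sigma>_def)
qed

lemma nn_integral_alive:
  assumes "x \<in> \<Omega>" "0 \<le> t"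
  shows "(\<integral>\<^sup>+ s\<in>{t..T}. ennreal (alive s x) \<partial>lborel) = ennreal (max 0 (\<tau> x - t))"
proof -
  have "(\<integral>\<^sup>+ s\<in>{t..T}. ennreal (alive s x) \<partial>lborel) = (\<integral>\<^sup>+ s. indicator {t..<\<tau> x} s \<partial>lborel)"
    using \<tau>[OF assms(1)] by (intro nn_integral_cong) (auto simp: alive_def indicator_def)
  also have "\<dots> = emeasure lborel {t..<\<tau> x}" by simp
  also have "\<dots> = ennreal (max 0 (\<tau> x - t))"
    by (cases "t \<le> \<tau> x") (auto simp: max_def)
  finally show ?thesis .
qed

lemma alive_abs: "\<bar>alive s x * alive s x\<bar> = alive s x" "(alive s x)\<^sup>2 = alive s x" "\<bar>alive s x\<bar> = alive s x"
  by (auto simp: alive_def)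

lemma admissible_alive: "admissible P F T alive alive"
  unfolding admissible_def
proof (intro conjI stochastic_basis_P progressively_measurable_alive)
  show "(\<integral>\<^sup>+ x. (\<integral>\<^sup>+ s\<in>{0..T}. ennreal (\<bar>alive s x\<bar>\<^sup>2) \<partial>lborel) \<partial>P) < \<infinity>"
    using nn_integral_alive[of _ 0] finite_\<Omega> by (simp add: alive_abs nn_integral_P ennreal_mult_less_top)
qed

text \<open>Given \<open>F t\<close>, the expected remaining lifetime is 0 off the survivors and a
  constant \<open>c\<close> on their atom, namely the weighted mean of \<open>\<tau> - t\<close>.
  The squared BMO norm is thus controlled by the mean residual life, and \<open>le\<close> bounds
  that mean with the denominator multiplied out.\<close>

lemma BMO_norm_alive_le:
  assumes K: "0 \<le> K"
    and le: "\<And>t. 0 \<le> t \<Longrightarrow> t < T \<Longrightarrow>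
      (\<Sum>x | x \<in> \<Omega> \<and> t < \<tau> x. w x * (\<tau> x - t)) \<le> K * (\<Sum>x | x \<in> \<Omega> \<and> t < \<tau> x. w x)"
  shows "BMO_norm P F T alive \<le> ennreal (sqrt K)"
  unfolding BMO_norm_def
proof (rule SUP_least)
  fix t assume t: "t \<in> {0..T}"
  let ?R = "\<lambda>x. \<integral>\<^sup>+ s\<in>{t..T}. ennreal (\<bar>alive s x\<bar>\<^sup>2) \<partial>lborel"
  let ?D = "{x \<in> \<Omega>. t < \<tau> x}"
  have R: "?R x = ennreal (max 0 (\<tau> x - t))" if "x \<in> \<Omega>" for x
    using nn_integral_alive[OF that, of t] t by (simp add: alive_abs)
  define c where "c = (\<Sum>x\<in>?D. w x * (\<tau> x - t)) / (\<Sum>x\<in>?D. w x)"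
  define g where "g x = (if t < \<tau> x then ennreal c else 0)" for x
  interpret stochastic_basis P F T by (rule stochastic_basis_P)
  have "finite_measure_subalgebra P (F t)"
    using subalgebra_F[OF t] by unfold_locales
  then have sfs: "sigma_finite_subalgebra P (F t)"
    by (rule finite_measure_subalgebra_is_sigma_finite)
  have fin_D: "finite ?D" using finite_\<Omega> by simp
  have c: "0 \<le> c \<and> c \<le> K \<and> (\<Sum>x\<in>?D. w x * (\<tau> x - t)) = c * (\<Sum>x\<in>?D. w x)"
  proof (cases "?D = {}")
    \<comment> \<open>Without survivors both sums are 0 and \<open>c\<close> is
      \<open>0 / 0 = 0\<close>.\<close>
    case True
    then show ?thesis using K by (simp only: c_def True) simp
  next
    case False
    then have pos: "0 < (\<Sum>x\<in>?D. w x)" using fin_D w_pos by (intro sum_pos) auto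
    from False have "t < T" using \<tau> by force
    with t have "(\<Sum>x\<in>?D. w x * (\<tau> x - t)) \<le> K * (\<Sum>x\<in>?D. w x)" by (intro le) auto
    moreover have "0 \<le> (\<Sum>x\<in>?D. w x * (\<tau> x - t))"
      using w_pos by (intro sum_nonneg mult_nonneg_nonneg) (auto intro: less_imp_le)
    ultimately show ?thesis using pos by (simp add: c_def divide_le_eq)
  qed
  have restrict: "(\<integral>\<^sup>+ x\<in>S. f x \<partial>P) = (\<Sum>x\<in>S \<inter> ?D. ennreal (w x) * f x)"
    if "S \<subseteq> \<Omega>" "\<And>x. x \<in> \<Omega> \<Longrightarrow> \<not> t < \<tau> x \<Longrightarrow> f x = 0" for S and f :: "'a \<Rightarrow> ennreal"
    unfolding nn_integral_P using that finite_\<Omega>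
    by (intro sum.mono_neutral_cong_right) (auto simp: indicator_def)
  have "AE x in P. g x = nn_cond_exp P (F t) ?R x"
  proof (rule sigma_finite_subalgebra.nn_cond_exp_charact[OF sfs])
    show "?R \<in> borel_measurable P" by (simp add: measurable_point_measure_eq1)
    show "g \<in> borel_measurable (F t)"
    proof (rule measurableI)
      fix A :: "ennreal set"
      show "g -` A \<inter> space (F t) \<in> sets (F t)" by (auto simp: sets_death_filtration g_def)
    qed simp
    fix S assume "S \<in> sets (F t)"
    \<comment> \<open>A set of \<open>F t\<close> contains all survivors or none, so the defining
      identity of the conditional expectation needs a check only on the whole atom.\<close>
    then have S: "S \<subseteq> \<Omega>" "S \<inter> ?D = {} \<or> S \<inter> ?D = ?D"
      by (auto simp: sets_death_filtration)
    have D_eq: "(\<Sum>x\<in>?D. ennreal (w x) * ?R x) = (\<Sum>x\<in>?D. ennreal (w x) * g x)"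
    proof -
      have "(\<Sum>x\<in>?D. ennreal (w x) * ?R x) = (\<Sum>x\<in>?D. ennreal (w x * (\<tau> x - t)))"
      proof (intro sum.cong refl)
        fix x assume "x \<in> ?D"
        then have "?R x = ennreal (\<tau> x - t)" "0 \<le> w x"
          using R[of x] w_pos[of x] by (auto simp: less_imp_le)
        then show "ennreal (w x) * ?R x = ennreal (w x * (\<tau> x - t))"
          by (metis ennreal_mult')
      qed
      also have "\<dots> = ennreal (\<Sum>x\<in>?D. w x * (\<tau> x - t))"
        using w_pos by (intro sum_ennreal) (auto simp: less_imp_le)
      also have "\<dots> = ennreal (\<Sum>x\<in>?D. w x * c)"
        using c by (simp add: sum_distrib_left mult.commute)
      also have "\<dots> = (\<Sum>x\<in>?D. ennreal (w x * c))"
        using w_pos c by (intro sum_ennreal[symmetric]) (auto simp: less_imp_le)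
      also have "\<dots> = (\<Sum>x\<in>?D. ennreal (w x) * g x)"
        using w_pos c by (intro sum.cong) (auto simp: g_def ennreal_mult' less_imp_le)
      finally show ?thesis .
    qed
    have "(\<integral>\<^sup>+ x\<in>S. ?R x \<partial>P) = (\<Sum>x\<in>S \<inter> ?D. ennreal (w x) * ?R x)"
      by (rule restrict[OF S(1)]) (simp only: R, simp)
    also have "\<dots> = (\<Sum>x\<in>S \<inter> ?D. ennreal (w x) * g x)"
      using S(2) D_eq by (elim disjE) simp_all
    also have "\<dots> = (\<integral>\<^sup>+ x\<in>S. g x \<partial>P)"
      by (rule restrict[OF S(1), symmetric]) (simp add: g_def)
    finally show "(\<integral>\<^sup>+ x\<in>S. ?R x \<partial>P) = (\<integral>\<^sup>+ x\<in>S. g x \<partial>P)" .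
  qed
  moreover have "g x \<le> ennreal K" for x using c by (simp add: g_def ennreal_leI)
  ultimately have "AE x in P. nn_cond_exp P (F t) ?R x \<le> ennreal K"
    by (elim eventually_mono) metis
  then have "esssup P (nn_cond_exp P (F t) ?R) \<le> ennreal K"
    by (intro esssup_I borel_measurable_nn_cond_exp2)
  then have "ennpowr (esssup P (nn_cond_exp P (F t) ?R)) (1/2) \<le> ennpowr (ennreal K) (1/2)"
    by (intro ennpowr_mono) auto
  also have "\<dots> = ennreal (sqrt K)"
    using K by (simp add: ennpowr_ennreal powr_half_sqrt)
  finally show "ennpowr (esssup P (nn_cond_exp P (F t) ?R)) (1/2) \<le> ennreal (sqrt K)" .
qed

text \<open>By Jensen's inequality, the \<open>H\<close> norm of \<open>alive\<close> is at most the square root of the \<open>p\<close>-norm of \<open>\<tau>\<close>.\<close>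
lemma product_bound_alive_imp:
  assumes pb: "product_bound P F T p c alive alive" and p: "0 < p"
  shows "ennpowr (\<integral>\<^sup>+ x. ennreal (\<tau> x powr p) \<partial>P) (1 / (2 * p)) \<le> c * BMO_norm P F T alive"
proof -
  let ?m = "\<integral>\<^sup>+ x. ennreal (\<tau> x powr p) \<partial>P"
  \<comment> \<open>The square root of the \<open>p\<close>-norm of \<open>\<tau>\<close>: the left
    side of the product bound is \<open>?e * ?e\<close> and the \<open>H\<close> norm is at most
    \<open>?e\<close>, so one factor cancels.\<close>
  let ?e = "ennpowr ?m (1 / (2 * p))"
  have alive0: "(\<integral>\<^sup>+ s\<in>{0..T}. ennreal (alive s x) \<partial>lborel) = ennreal (\<tau> x)" if "x \<in> \<Omega>" for x
    using nn_integral_alive[OF that, of 0] \<tau>[OF that] by simp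
  have L: "Lp_norm P p (\<lambda>x. \<integral>\<^sup>+ s\<in>{0..T}. ennreal \<bar>alive s x * alive s x\<bar> \<partial>lborel) = ennpowr ?m (1 / p)"
    using \<tau> unfolding Lp_norm_def nn_integral_P
    by (intro arg_cong2[where f = ennpowr] sum.cong refl)
      (auto simp: alive_abs powr_powr alive0 ennpowr_ennreal less_imp_le)
  let ?h = "\<integral>\<^sup>+ x. ennreal (\<tau> x powr (p / 2)) \<partial>P"
  have H: "H_norm P T p alive = ennpowr ?h (1 / p)"
    using \<tau> unfolding H_norm_def Lp_norm_def nn_integral_P
    by (intro arg_cong2[where f = ennpowr] sum.cong refl)
      (auto simp: alive_abs powr_powr alive0 ennpowr_ennreal ennpowr_ennpowr less_imp_le)
  interpret stochastic_basis P F T by (rule stochastic_basis_P)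
  \<comment> \<open>Jensen's inequality in the form of Cauchy--Schwarz against the constant
    1.\<close>
  have "(\<integral>\<^sup>+ x. ennreal (\<tau> x powr (p / 2)) * 1 \<partial>P)\<^sup>2
      \<le> (\<integral>\<^sup>+ x. (ennreal (\<tau> x powr (p / 2)))\<^sup>2 \<partial>P) * (\<integral>\<^sup>+ x. 1\<^sup>2 \<partial>P)"
    by (rule Cauchy_Schwarz_nn_integral) (simp_all add: measurable_point_measure_eq1)
  also have "(\<integral>\<^sup>+ x. (ennreal (\<tau> x powr (p / 2)))\<^sup>2 \<partial>P) = ?m"
  proof (intro nn_integral_cong)
    fix x
    have "(\<tau> x powr (p / 2))\<^sup>2 = \<tau> x powr p"
      by (simp add: power2_eq_square flip: powr_add)
    then show "(ennreal (\<tau> x powr (p / 2)))\<^sup>2 = ennreal (\<tau> x powr p)"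
      by (simp add: ennreal_power)
  qed
  also have "(\<integral>\<^sup>+ x. 1\<^sup>2 \<partial>P) = 1" by (simp add: emeasure_space_1)
  finally have "ennpowr ?h 2 \<le> ?m" by (simp add: ennpowr_2)
  then have "ennpowr (ennpowr ?h 2) (1 / (2 * p)) \<le> ?e"
    using p by (intro ennpowr_mono) auto
  then have "H_norm P T p alive \<le> ?e" by (simp add: H ennpowr_ennpowr)
  then have "c * H_norm P T p alive * BMO_norm P F T alive \<le> c * ?e * BMO_norm P F T alive"
    by (intro mult_right_mono mult_left_mono) auto
  moreover have "ennpowr ?m (1 / p) = ?e * ?e"
  proof -
    have "?e * ?e = ennpowr ?e 2" by (simp add: ennpowr_2 power2_eq_square)
    then show ?thesis by (simp add: ennpowr_ennpowr)
  qed
  moreover have "ennpowr ?m (1 / p) \<le> c * H_norm P T p alive * BMO_norm P F T alive"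
    using pb unfolding product_bound_def L .
  ultimately have "?e * ?e \<le> c * ?e * BMO_norm P F T alive" by simp
  then have *: "?e * ?e \<le> ?e * (c * BMO_norm P F T alive)" by (simp only: mult_ac)
  \<comment> \<open>Cancelling \<open>?e\<close> requires it to be neither 0 nor infinite.\<close>
  have "?m < \<top>" using finite_\<Omega> by (simp add: nn_integral_P ennreal_mult_less_top)
  moreover have "?m \<noteq> 0"
  proof
    assume "?m = 0"
    then have "AE x in P. ennreal (\<tau> x powr p) = 0"
      by (subst (asm) nn_integral_0_iff_AE) (auto simp: measurable_point_measure_eq1)
    then have "\<tau> x powr p \<le> 0" if "x \<in> \<Omega>" for x
      using that by (simp add: AE_P ennreal_eq_0_iff)
    moreover have "0 < \<tau> x powr p" if "x \<in> \<Omega>" for x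
      using \<tau>[OF that] by simp
    ultimately have "\<Omega> = {}" by fastforce
    then show False using w_sum by simp
  qed
  ultimately have "?e \<noteq> 0" "?e < \<top>" by simp_all
  then have "?e \<noteq> 0" "?e \<noteq> \<top>" by (metis less_irrefl)+
  then show ?thesis using * ennreal_mult_le_mult_iff by blast
qed

end

section \<open>The truncated geometric law and the extremal example\<close>

definition geom_weight :: "nat \<Rightarrow> nat \<Rightarrow> real" where
  "geom_weight n i = (if i < n then (1/2) ^ Suc i else (1/2) ^ n)"

text \<open>The last weight carries the whole remaining tail of the geometric series, so every upper
  tail keeps its untruncated mass; the induction runs downwards from \<open>n\<close>.\<close>

lemma sum_geom_weight: "j \<le> n \<Longrightarrow> (\<Sum>i=j..n. geom_weight n i) = (1/2) ^ j"
  by (induction rule: inc_induct) (simp_all add: geom_weight_def sum.atLeast_Suc_atMost)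

text \<open>Lowering the start from \<open>Suc j\<close> to \<open>j\<close> adds the tail mass
  \<open>(1/2) ^ j\<close>. The sum is therefore dominated by a geometric series, and the mean
  residual life is at most 2 grid steps from every starting index.\<close>

lemma sum_geom_weight_mult_le:
  "j \<le> n \<Longrightarrow> (\<Sum>i=j..n. geom_weight n i * (real i + 1 - real j)) \<le> 2 * (1/2) ^ j"
proof (induction rule: inc_induct)
  case base
  then show ?case by (simp add: geom_weight_def)
next
  case (step j)
  have "(\<Sum>i=j..n. geom_weight n i * (real i + 1 - real j))
      = geom_weight n j + (\<Sum>i=Suc j..n. geom_weight n i * (real i + 1 - real j))"
    using step by (simp add: sum.atLeast_Suc_atMost)
  also have "(\<Sum>i=Suc j..n. geom_weight n i * (real i + 1 - real j))
      = (\<Sum>i=Suc j..n. geom_weight n i) + (\<Sum>i=Suc j..n. geom_weight n i * (real i + 1 - real (Suc j)))"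
    by (simp add: sum.distrib[symmetric] algebra_simps)
  also have "geom_weight n j + \<dots> = (1/2) ^ j + (\<Sum>i=Suc j..n. geom_weight n i * (real i + 1 - real (Suc j)))"
    using step sum_geom_weight[of j n] by (simp add: sum.atLeast_Suc_atMost)
  also have "\<dots> \<le> 2 * (1/2) ^ j" using step.IH by simp
  finally show ?case .
qed

text \<open>An infinite type has room for the \<open>n + 1\<close> sample points for every
  \<open>n\<close>. The example gives \<open>sqrt (T / 2) \<le> c * sqrt (2 * \<delta>)\<close>, and
  \<open>\<delta> \<le> T / p\<close> turns this into \<open>sqrt p / 2 \<le> c\<close>.\<close>

lemma c_opt_ge:
  fixes T p :: real
  assumes T: "0 < T" and p: "2 \<le> p"
  shows "ennreal (sqrt p / 2) \<le> c_opt TYPE('b :: infinite) T p"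
proof -
  obtain e :: "nat \<Rightarrow> 'b" where e: "inj e"
    using infinite_countable_subset[OF infinite_UNIV] by auto
  \<comment> \<open>Both sides of the floor matter: \<open>n \<le> p\<close> makes the probability
    \<open>(1/2) ^ n\<close> of \<open>\<tau> = T\<close> at least \<open>(1/2) powr p\<close>, and
    \<open>p \<le> n + 1\<close> makes the mesh at most \<open>T / p\<close>.\<close>
  define n where "n = nat \<lfloor>p\<rfloor>"
  have n: "real n \<le> p" "p \<le> real n + 1" using p unfolding n_def by linarith+
  define \<delta> where "\<delta> = T / real (Suc n)"
  have \<delta>: "0 < \<delta>" "(real n + 1) * \<delta> = T" using T by (simp_all add: \<delta>_def field_simps)
  define k where "k = inv e"
  have k [simp]: "k (e i) = i" for i using e by (simp add: k_def)
  define \<Omega> where "\<Omega> = e ` {..n}"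
  define w where "w x = geom_weight n (k x)" for x
  \<comment> \<open>The shift by 1 keeps \<open>\<tau>\<close> positive and makes it equal to
    \<open>T\<close> at the last index \<open>n\<close>.\<close>
  define \<tau> where "\<tau> x = (real (k x) + 1) * \<delta>" for x
  have sum_e: "(\<Sum>x\<in>e ` I. f (k x)) = (\<Sum>i\<in>I. f i)" for f :: "nat \<Rightarrow> real" and I
    using e by (subst sum.reindex) (auto intro: inj_on_subset)
  interpret death_time \<Omega> w \<tau> T
  proof
    show "finite \<Omega>" by (simp add: \<Omega>_def)
    show "0 < w x" for x by (simp add: w_def geom_weight_def)
    show "sum w \<Omega> = 1"
      using sum_geom_weight[of 0 n] by (simp add: \<Omega>_def w_def sum_e atLeast0AtMost)
    fix x assume "x \<in> \<Omega>"
    then have "(real (k x) + 1) * \<delta> \<le> (real n + 1) * \<delta>"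
      using \<delta> by (intro mult_right_mono) (auto simp: \<Omega>_def)
    then show "0 < \<tau> x \<and> \<tau> x \<le> T" using \<delta> by (simp add: \<tau>_def add_nonneg_pos)
  qed
  have BMO: "BMO_norm P F T alive \<le> ennreal (sqrt (2 * \<delta>))"
  proof (rule BMO_norm_alive_le)
    fix t assume t: "0 \<le> t" "t < T"
    \<comment> \<open>The first index whose death time \<open>(j + 1) * \<delta>\<close> lies after
      \<open>t\<close>, so the survivors are the indices from \<open>j\<close> on. As
      \<open>j * \<delta> \<le> t\<close>, replacing \<open>t\<close> by \<open>j * \<delta>\<close>
      only lengthens the remaining lifetimes.\<close>
    define j where "j = nat \<lfloor>t / \<delta>\<rfloor>"
    have j_iff: "t < (real i + 1) * \<delta> \<longleftrightarrow> j \<le> i" for i :: nat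
    proof -
      have "t < (real i + 1) * \<delta> \<longleftrightarrow> t / \<delta> < real i + 1" using \<delta> by (simp add: divide_less_eq)
      also have "\<dots> \<longleftrightarrow> \<lfloor>t / \<delta>\<rfloor> \<le> int i" by linarith
      also have "\<dots> \<longleftrightarrow> j \<le> i" unfolding j_def by linarith
      finally show ?thesis .
    qed
    have "j \<le> n" using j_iff[of n] t \<delta> by simp
    have jt: "real j * \<delta> \<le> t"
    proof -
      have "real j \<le> t / \<delta>" using t \<delta> by (simp add: j_def)
      then show ?thesis using \<delta> by (simp add: le_divide_eq)
    qed
    have D: "{x. x \<in> \<Omega> \<and> t < \<tau> x} = e ` {j..n}"
      by (auto simp: \<Omega>_def \<tau>_def j_iff)
    have "(\<Sum>x | x \<in> \<Omega> \<and> t < \<tau> x. w x * (\<tau> x - t)) = (\<Sum>i=j..n. geom_weight n i * ((real i + 1) * \<delta> - t))"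
      unfolding D unfolding w_def \<tau>_def
      by (rule sum_e[where f = "\<lambda>i. geom_weight n i * ((real i + 1) * \<delta> - t)"])
    also have "\<dots> \<le> (\<Sum>i=j..n. \<delta> * (geom_weight n i * (real i + 1 - real j)))"
    proof (rule sum_mono)
      fix i
      have "geom_weight n i * ((real i + 1) * \<delta> - t) \<le> geom_weight n i * ((real i + 1) * \<delta> - real j * \<delta>)"
        using jt by (intro mult_left_mono) (auto simp: geom_weight_def)
      then show "geom_weight n i * ((real i + 1) * \<delta> - t) \<le> \<delta> * (geom_weight n i * (real i + 1 - real j))"
        by (simp add: algebra_simps)
    qed
    also have "\<dots> = \<delta> * (\<Sum>i=j..n. geom_weight n i * (real i + 1 - real j))"
      by (simp add: sum_distrib_left)
    also have "\<dots> \<le> \<delta> * (2 * (1/2) ^ j)"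
      using \<delta> sum_geom_weight_mult_le[OF \<open>j \<le> n\<close>] by (intro mult_left_mono) auto
    also have "(1/2) ^ j = (\<Sum>x | x \<in> \<Omega> \<and> t < \<tau> x. w x)"
      unfolding D w_def sum_e using sum_geom_weight[OF \<open>j \<le> n\<close>] by simp
    finally show "(\<Sum>x | x \<in> \<Omega> \<and> t < \<tau> x. w x * (\<tau> x - t)) \<le> 2 * \<delta> * (\<Sum>x | x \<in> \<Omega> \<and> t < \<tau> x. w x)"
      by (simp add: mult_ac)
  qed (use \<delta> in simp)
  let ?m = "\<integral>\<^sup>+ x. ennreal (\<tau> x powr p) \<partial>P"
  have m: "ennreal (sqrt (T / 2)) \<le> ennpowr ?m (1 / (2 * p))"
  proof -
    have "sqrt (T / 2) = (T / 2) powr (1/2)" using T by (simp add: powr_half_sqrt)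
    also have "\<dots> = ((T / 2) powr p) powr (1 / (2 * p))" using p by (simp add: powr_powr)
    finally have "ennreal (sqrt (T / 2)) = ennpowr (ennreal ((T / 2) powr p)) (1 / (2 * p))"
      by (simp add: ennpowr_ennreal)
    also have "\<dots> \<le> ennpowr ?m (1 / (2 * p))"
    proof (rule ennpowr_mono)
      \<comment> \<open>The single sample point \<open>e n\<close>, where \<open>\<tau>\<close>
        equals \<open>T\<close>, already contributes enough to the \<open>p\<close>-th
        moment.\<close>
      have "(T / 2) powr p = (1/2) powr p * T powr p"
        using T by (simp add: powr_mult[symmetric])
      also have "(1/2::real) powr p \<le> (1/2) powr real n"
        using n by (intro powr_mono') auto
      also have "(1/2::real) powr real n = (1/2) ^ n" by (simp add: powr_realpow)
      finally have "(T / 2) powr p \<le> (1/2) ^ n * T powr p" by (simp add: mult_right_mono)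
      then have "ennreal ((T / 2) powr p) \<le> ennreal ((1/2) ^ n * T powr p)" by (rule ennreal_leI)
      also have "\<dots> = ennreal (w (e n)) * ennreal (\<tau> (e n) powr p)"
        using \<delta> by (simp add: w_def \<tau>_def geom_weight_def ennreal_mult)
      also have "\<dots> \<le> ?m"
        unfolding nn_integral_P using finite_\<Omega> by (intro member_le_sum) (auto simp: \<Omega>_def)
      finally show "ennreal ((T / 2) powr p) \<le> ?m" .
    qed (use p in simp)
    finally show ?thesis .
  qed
  show ?thesis
    unfolding c_opt_def
  proof (rule Inf_greatest)
    fix c assume "c \<in> {c. \<forall>(M :: 'b measure) F A B. admissible M F T A B \<longrightarrow> product_bound M F T p c A B}"
    then have "product_bound P F T p c alive alive" using admissible_alive by blast
    then have "ennpowr ?m (1 / (2 * p)) \<le> c * BMO_norm P F T alive"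
      using p by (intro product_bound_alive_imp) auto
    with m have "ennreal (sqrt (T / 2)) \<le> c * BMO_norm P F T alive" by (rule order.trans)
    also have "\<dots> \<le> c * ennreal (sqrt (2 * \<delta>))"
      using BMO by (rule mult_left_mono) simp
    finally have le: "ennreal (sqrt (T / 2)) \<le> c * ennreal (sqrt (2 * \<delta>))" .
    show "ennreal (sqrt p / 2) \<le> c"
    proof (cases c)
      case (real r)
      have "sqrt (T / 2) \<le> r * sqrt (2 * \<delta>)"
        using le real \<delta> by (simp flip: ennreal_mult)
      \<comment> \<open>The bound \<open>2 * T / p\<close> is written so as to expose the factor
        \<open>sqrt (T / 2)\<close>, which then cancels.\<close>
      also have "\<dots> \<le> r * sqrt (4 * (T / 2) / p)"
      proof -
        have "\<delta> \<le> T / p" using T n p by (simp add: \<delta>_def frac_le)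
        then show ?thesis using real by (intro mult_left_mono) auto
      qed
      also have "sqrt (4 * (T / 2) / p) = sqrt 4 * sqrt (T / 2) / sqrt p"
        by (simp only: real_sqrt_divide real_sqrt_mult)
      finally have "sqrt (T / 2) * 1 \<le> sqrt (T / 2) * (2 * r / sqrt p)" by (simp add: mult_ac)
      then have "1 \<le> 2 * r / sqrt p" using T by (subst (asm) mult_le_cancel_left_pos) auto
      then have "sqrt p / 2 \<le> r" using p by (simp add: le_divide_eq)
      then show ?thesis using real by (simp add: ennreal_leI)
    qed simp
  qed
qed

theorem corollary5p19:
  fixes T :: real
  assumes "0 < T"
  shows "(\<forall>(M :: 'a measure) F A B p.
            admissible M F T A B \<and> 1 \<le> p \<longrightarrow>
            product_bound M F T p (ennreal (sqrt (2 * p))) A B) \<and>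
         0 < (INF p\<in>{2..}. c_opt TYPE('b :: infinite) T p / ennreal (sqrt p))"
proof
  show "\<forall>(M :: 'a measure) F A B p. admissible M F T A B \<and> 1 \<le> p \<longrightarrow>
      product_bound M F T p (ennreal (sqrt (2 * p))) A B"
    using product_bound_sqrt by blast
  have "ennreal (1/2) \<le> (INF p\<in>{2..}. c_opt TYPE('b) T p / ennreal (sqrt p))"
  proof (rule INF_greatest)
    fix p :: real assume "p \<in> {2..}"
    then have p: "2 \<le> p" by simp
    have "ennreal (1/2) = ennreal (sqrt p / 2) / ennreal (sqrt p)"
      using p by (subst divide_ennreal) auto
    also have "\<dots> \<le> c_opt TYPE('b) T p / ennreal (sqrt p)"
      by (rule divide_right_mono_ennreal[OF c_opt_ge[OF assms p]])
    finally show "ennreal (1/2) \<le> c_opt TYPE('b) T p / ennreal (sqrt p)" .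
  qed
  moreover have "0 < ennreal (1/2)" by (rule ennreal_less_zero_iff[THEN iffD2]) simp
  ultimately show "0 < (INF p\<in>{2..}. c_opt TYPE('b) T p / ennreal (sqrt p))"
    by (rule less_le_trans[rotated])
qed

end
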